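(* Let $K$ be a commutative ring and let $A=\sigma(R)\langle x_1,\dots,x_n\rangle$ be a bijective skew $PBW$ extension of a left strongly Noetherian $K$-algebra $R$, where $A$ is a $K$-algebra. Then $A$ is left strongly Noetherian.
   Context: Rings are associative with unit. The $K$-algebra structure on $A$ is the one extending that of $R\subseteq A$. Skew $PBW$ extension: let $R,A$ be rings. $A$ is a skew $PBW$ extension of $R$, written $A=\sigma(R)\langle x_1,\dots,x_n\rangle$, if: (i) $R\subseteq A$ is a subring; (ii) there are finitely many elements $x_1,\dots,x_n\in A$ such that $A$ is a free left $R$-module with basis $\{x_1^{\alpha_1}\cdots x_n^{\alpha_n}\mid (\alpha_1,\dots,\alpha_n)\in\mathbb{N}^n\}$, with $\mathbb{N}=\{0,1,2,\dots\}$; (iii) for every $1\le i\le n$ and $r\in R\setminus\{0\}$ there is $c_{i,r}\in R\setminus\{0\}$ with $x_ir-c_{i,r}x_i\in R$; (iv) for every $1\le i,j\le n$ there is $c_{i,j}\in R\setminus\{0\}$ with $x_jx_i-c_{i,j}x_ix_j\in R+Rx_1+\cdots+Rx_n$. For such $A$ there exist, for each $i$, an injective ring endomorphism $\sigma_i$ of $R$ and a $\sigma_i$-derivation $\delta_i$ of $R$ with $x_ir=\sigma_i(r)x_i+\delta_i(r)$ for all $r\in R$. $A$ is bijective if every $\sigma_i$ is bijective and $c_{i,j}$ is invertible for all $1\le i<j\le n$. Let $K$ be a commutative ring and $B$ a left Noetherian $K$-algebra. $B$ is left strongly Noetherian if for every commutative Noetherian $K$-algebra $C$, the ring $C\otimes_K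 B$ is left Noetherian. *)

theory Defs
  imports "HOL-Algebra.Free_Abelian_Groups" "HOL-Algebra.Algebra"
begin

section \<open>Left Noetherian rings and noncommutative algebras\<close>

locale left_ideal = additive_subgroup I R + ring R for I and R (structure) +
  assumes left_closed: "\<lbrakk>a \<in> I; x \<in> carrier R\<rbrakk> \<Longrightarrow> x \<otimes> a \<in> I"

definition gen_left_ideal :: "('a, 'm) ring_scheme \<Rightarrow> 'a set \<Rightarrow> 'a set"
  where "gen_left_ideal R S = \<Inter>{I. left_ideal I R \<and> S \<subseteq> I}"

text \<open>The one-sided analogue of the library locale \<^locale>\<open>noetherian_ring\<close>, which is about
  two-sided ideals.\<close>

locale left_noetherian_ring = ring +
  assumes left_finitely_gen:
    "left_ideal I R \<Longrightarrow> \<exists>F \<subseteq> carrier R. finite F \<and> I = gen_left_ideal R F"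

text \<open>The library locale \<^locale>\<open>algebra\<close> requires the algebra to be commutative. For a
  noncommutative one, scalars have to pass through both factors of a product.\<close>

locale ring_algebra = module K B + ring B for K (structure) and B (structure) +
  assumes smult_mult_left:
      "\<lbrakk>k \<in> carrier K; a \<in> carrier B; b \<in> carrier B\<rbrakk> \<Longrightarrow>
        (k \<odot>\<^bsub>B\<^esub> a) \<otimes>\<^bsub>B\<^esub> b = k \<odot>\<^bsub>B\<^esub> (a \<otimes>\<^bsub>B\<^esub> b)"
    and smult_mult_right:
      "\<lbrakk>k \<in> carrier K; a \<in> carrier B; b \<in> carrier B\<rbrakk> \<Longrightarrow>
        a \<otimes>\<^bsub>B\<^esub> (k \<odot>\<^bsub>B\<^esub> b) = k \<odot>\<^bsub>B\<^esub> (a \<otimes>\<^bsub>B\<^esub> b)"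

section \<open>The tensor product of two algebras\<close>

text \<open>The monoid ring $\mathbb{Z}[M]$. Its additive group is the library's
  \<^const>\<open>free_Abelian_group\<close> on the carrier of \<open>M\<close>.\<close>

definition int_monoid_ring :: "('a, 'm) monoid_scheme \<Rightarrow> ('a \<Rightarrow>\<^sub>0 int) ring"
  where "int_monoid_ring M =
    \<lparr>carrier = carrier (free_Abelian_group (carrier M)),
     monoid.mult = (\<lambda>f g. frag_extend (\<lambda>p. frag_extend (\<lambda>q. frag_of (p \<otimes>\<^bsub>M\<^esub> q)) g) f),
     one = frag_of \<one>\<^bsub>M\<^esub>,
     ring.zero = 0,
     ring.add = (+)\<rparr>"

inductive_set tensor_relators ::
    "('k, 'l) ring_scheme \<Rightarrow> ('k, 'c, 'm) module_scheme \<Rightarrow> ('k, 'b, 'n) module_scheme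
      \<Rightarrow> ('c \<times> 'b \<Rightarrow>\<^sub>0 int) set"
  for K C B
  where
    add_left: "\<lbrakk>c \<in> carrier C; c' \<in> carrier C; b \<in> carrier B\<rbrakk> \<Longrightarrow>
      frag_of (c \<oplus>\<^bsub>C\<^esub> c', b) - frag_of (c, b) - frag_of (c', b) \<in> tensor_relators K C B"
  | add_right: "\<lbrakk>c \<in> carrier C; b \<in> carrier B; b' \<in> carrier B\<rbrakk> \<Longrightarrow>
      frag_of (c, b \<oplus>\<^bsub>B\<^esub> b') - frag_of (c, b) - frag_of (c, b') \<in> tensor_relators K C B"
  | balanced: "\<lbrakk>k \<in> carrier K; c \<in> carrier C; b \<in> carrier B\<rbrakk> \<Longrightarrow>
      frag_of (k \<odot>\<^bsub>C\<^esub> c, b) - frag_of (c, k \<odot>\<^bsub>B\<^esub> b) \<in> tensor_relators K C B"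

definition tensor_kernel ::
    "('k, 'l) ring_scheme \<Rightarrow> ('k, 'c, 'm) module_scheme \<Rightarrow> ('k, 'b, 'n) module_scheme
      \<Rightarrow> ('c \<times> 'b \<Rightarrow>\<^sub>0 int) set"
  where "tensor_kernel K C B =
    generate (free_Abelian_group (carrier C \<times> carrier B)) (tensor_relators K C B)"

text \<open>As an abelian group this is the usual construction of $C \otimes_K B$: the free abelian group
  on $C \times B$ modulo the subgroup generated by the relators. That subgroup is an ideal of
  $\mathbb{Z}[C \times B]$ (\<open>tensor_kernel_ideal\<close> below), and the product of the quotient ring is
  $(c \otimes b)(c' \otimes b') = cc' \otimes bb'$ (\<open>pure_tensor_mult\<close> below).\<close>

definition tensor_algebra_ring ::
    "('k, 'l) ring_scheme \<Rightarrow> ('k, 'c, 'm) module_scheme \<Rightarrow> ('k, 'b, 'n) module_scheme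
      \<Rightarrow> ('c \<times> 'b \<Rightarrow>\<^sub>0 int) set ring"
  where "tensor_algebra_ring K C B = int_monoid_ring (C \<times>\<times> B) Quot tensor_kernel K C B"

definition pure_tensor ::
    "('k, 'l) ring_scheme \<Rightarrow> ('k, 'c, 'm) module_scheme \<Rightarrow> ('k, 'b, 'n) module_scheme
      \<Rightarrow> 'c \<Rightarrow> 'b \<Rightarrow> ('c \<times> 'b \<Rightarrow>\<^sub>0 int) set"
  where "pure_tensor K C B c b =
    tensor_kernel K C B +>\<^bsub>int_monoid_ring (C \<times>\<times> B)\<^esub> frag_of (c, b)"

lemma int_monoid_ring_simps [simp]:
  "carrier (int_monoid_ring M) = {f. Poly_Mapping.keys f \<subseteq> carrier M}"
  "\<zero>\<^bsub>int_monoid_ring M\<^esub> = 0"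
  "\<one>\<^bsub>int_monoid_ring M\<^esub> = frag_of \<one>\<^bsub>M\<^esub>"
  "f \<oplus>\<^bsub>int_monoid_ring M\<^esub> g = f + g"
  by (simp_all add: int_monoid_ring_def free_Abelian_group_def)

lemma int_monoid_ring_mult:
  "f \<otimes>\<^bsub>int_monoid_ring M\<^esub> g =
    frag_extend (\<lambda>p. frag_extend (\<lambda>q. frag_of (p \<otimes>\<^bsub>M\<^esub> q)) g) f"
  by (simp add: int_monoid_ring_def)

lemma int_monoid_ring_mult_of [simp]:
  "frag_of p \<otimes>\<^bsub>int_monoid_ring M\<^esub> frag_of q = frag_of (p \<otimes>\<^bsub>M\<^esub> q)"
  by (simp add: int_monoid_ring_mult)

lemma frag_extend_diff_fun:
  fixes f g :: "'a \<Rightarrow> 'b \<Rightarrow>\<^sub>0 int"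
  shows "frag_extend (\<lambda>p. f p - g p) x = frag_extend f x - frag_extend g x"
proof -
  have "frag_cmul c (a - b) = frag_cmul c a - frag_cmul c b" for c and a b :: "'b \<Rightarrow>\<^sub>0 int"
    by (rule poly_mapping_eqI) (simp add: lookup_minus algebra_simps)
  then show ?thesis by (simp add: frag_extend_def sum_subtractf)
qed

lemma int_monoid_ring_diff_left:
  "(f - g) \<otimes>\<^bsub>int_monoid_ring M\<^esub> h =
    f \<otimes>\<^bsub>int_monoid_ring M\<^esub> h - g \<otimes>\<^bsub>int_monoid_ring M\<^esub> h"
  by (simp add: int_monoid_ring_mult frag_extend_diff)

lemma int_monoid_ring_diff_right:
  "f \<otimes>\<^bsub>int_monoid_ring M\<^esub> (g - h) =
    f \<otimes>\<^bsub>int_monoid_ring M\<^esub> g - f \<otimes>\<^bsub>int_monoid_ring M\<^esub> h"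
  by (simp add: int_monoid_ring_mult frag_extend_diff frag_extend_diff_fun)

lemma int_monoid_ring_add_left:
  "(f + g) \<otimes>\<^bsub>int_monoid_ring M\<^esub> h =
    f \<otimes>\<^bsub>int_monoid_ring M\<^esub> h + g \<otimes>\<^bsub>int_monoid_ring M\<^esub> h"
  by (simp add: int_monoid_ring_mult frag_extend_add)

lemma int_monoid_ring_add_right:
  "f \<otimes>\<^bsub>int_monoid_ring M\<^esub> (g + h) =
    f \<otimes>\<^bsub>int_monoid_ring M\<^esub> g + f \<otimes>\<^bsub>int_monoid_ring M\<^esub> h"
  using int_monoid_ring_diff_right[where f = f and M = M and g = "g + h" and h = h] by simp

lemma int_monoid_ring_zero_mult [simp]:
  "0 \<otimes>\<^bsub>int_monoid_ring M\<^esub> f = 0" "f \<otimes>\<^bsub>int_monoid_ring M\<^esub> 0 = 0"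
  using int_monoid_ring_diff_right[where f = f and M = M and g = 0 and h = 0] by (simp_all add: int_monoid_ring_mult)

lemmas int_monoid_ring_arith =
  int_monoid_ring_diff_left int_monoid_ring_diff_right

context monoid
begin

lemma int_monoid_ring_mult_closed:
  assumes "Poly_Mapping.keys f \<subseteq> carrier G" "Poly_Mapping.keys g \<subseteq> carrier G"
  shows "Poly_Mapping.keys (f \<otimes>\<^bsub>int_monoid_ring G\<^esub> g) \<subseteq> carrier G"
  using assms(1)
proof (induction f rule: frag_induction)
  case (one p)
  show ?case
    using assms(2)
  proof (induction g rule: frag_induction)
    case (diff a b)
    then show ?case
      using keys_diff by (fastforce simp: int_monoid_ring_arith)
  qed (use one in auto)
next
  case (diff a b)
  then show ?case
    using keys_diff by (fastforce simp: int_monoid_ring_arith)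
qed auto

lemma int_monoid_ring_assoc:
  assumes "Poly_Mapping.keys f \<subseteq> carrier G" "Poly_Mapping.keys g \<subseteq> carrier G"
    "Poly_Mapping.keys h \<subseteq> carrier G"
  shows "f \<otimes>\<^bsub>int_monoid_ring G\<^esub> g \<otimes>\<^bsub>int_monoid_ring G\<^esub> h =
    f \<otimes>\<^bsub>int_monoid_ring G\<^esub> (g \<otimes>\<^bsub>int_monoid_ring G\<^esub> h)"
  using assms(1)
proof (induction f rule: frag_induction)
  case (one p)
  show ?case
    using assms(2)
  proof (induction g rule: frag_induction)
    case (one q)
    show ?case
      using assms(3)
    proof (induction h rule: frag_induction)
      case (one r)
      then show ?case
        using \<open>p \<in> carrier G\<close> \<open>q \<in> carrier G\<close> by (simp add: m_assoc)
    qed (simp_all add: int_monoid_ring_arith)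
  qed (simp_all add: int_monoid_ring_arith)
qed (simp_all add: int_monoid_ring_arith)

lemma int_monoid_ring_one:
  assumes "Poly_Mapping.keys f \<subseteq> carrier G"
  shows "frag_of \<one> \<otimes>\<^bsub>int_monoid_ring G\<^esub> f = f" "f \<otimes>\<^bsub>int_monoid_ring G\<^esub> frag_of \<one> = f"
  using assms by (induction f rule: frag_induction) (simp_all add: int_monoid_ring_arith)

lemma int_monoid_ring_is_ring: "ring (int_monoid_ring G)"
proof (rule ringI)
  show "abelian_group (int_monoid_ring G)"
  proof (rule abelian_groupI)
    fix f assume "f \<in> carrier (int_monoid_ring G)"
    then show "\<exists>g\<in>carrier (int_monoid_ring G). g \<oplus>\<^bsub>int_monoid_ring G\<^esub> f = \<zero>\<^bsub>int_monoid_ring G\<^esub>"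
      by (intro bexI[of _ "- f"]) auto
  qed (auto dest: subsetD[OF keys_add])
  show "monoid (int_monoid_ring G)"
    by (rule monoidI)
      (simp_all add: int_monoid_ring_mult_closed int_monoid_ring_assoc int_monoid_ring_one)
qed (simp_all add: int_monoid_ring_add_left int_monoid_ring_add_right)

end

lemma tensor_relators_carrier:
  assumes "module K C" "module K B" "t \<in> tensor_relators K C B"
  shows "Poly_Mapping.keys t \<subseteq> carrier C \<times> carrier B"
proof -
  interpret C: module K C by fact
  interpret B: module K B by fact
  show ?thesis
    using assms(3)
    by cases (auto dest!: subsetD[OF keys_diff])
qed

lemma tensor_relators_mult:
  assumes "ring_algebra K C" "ring_algebra K B" "t \<in> tensor_relators K C B"
    and d: "d \<in> carrier C" and e: "e \<in> carrier B"
  shows "frag_of (d, e) \<otimes>\<^bsub>int_monoid_ring (C \<times>\<times> B)\<^esub> t \<in> tensor_relators K C B"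
    and "t \<otimes>\<^bsub>int_monoid_ring (C \<times>\<times> B)\<^esub> frag_of (d, e) \<in> tensor_relators K C B"
proof -
  interpret C: ring_algebra K C by fact
  interpret B: ring_algebra K B by fact
  show "frag_of (d, e) \<otimes>\<^bsub>int_monoid_ring (C \<times>\<times> B)\<^esub> t \<in> tensor_relators K C B"
    using assms(3)
    by cases (use d e in \<open>auto simp: int_monoid_ring_arith C.r_distr B.r_distr
      C.smult_mult_right B.smult_mult_right intro: tensor_relators.intros\<close>)
  show "t \<otimes>\<^bsub>int_monoid_ring (C \<times>\<times> B)\<^esub> frag_of (d, e) \<in> tensor_relators K C B"
    using assms(3)
    by cases (use d e in \<open>auto simp: int_monoid_ring_arith C.l_distr B.l_distr
      C.smult_mult_left B.smult_mult_left intro: tensor_relators.intros\<close>)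
qed

lemma tensor_kernel_ideal:
  assumes "ring_algebra K C" "ring_algebra K B"
  shows "ideal (tensor_kernel K C B) (int_monoid_ring (C \<times>\<times> B))"
proof -
  interpret C: ring_algebra K C by fact
  interpret B: ring_algebra K B by fact
  let ?G = "free_Abelian_group (carrier C \<times> carrier B)"
  let ?Z = "int_monoid_ring (C \<times>\<times> B)"
  interpret M: monoid "C \<times>\<times> B"
    by (intro DirProd_monoid C.monoid_axioms B.monoid_axioms)
  interpret G: group ?G by simp
  have rel: "tensor_relators K C B \<subseteq> carrier ?G"
    using tensor_relators_carrier[OF C.module_axioms B.module_axioms] by auto
  have sub: "subgroup (tensor_kernel K C B) ?G"
    unfolding tensor_kernel_def by (rule G.generate_is_subgroup[OF rel])
  have diff: "a - b \<in> tensor_kernel K C B"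
    if "a \<in> tensor_kernel K C B" "b \<in> tensor_kernel K C B" for a b
    using subgroup.m_closed[OF sub that(1) subgroup.m_inv_closed[OF sub that(2)]]
      subgroup.mem_carrier[OF sub that(2)] by simp
  have zero: "0 \<in> tensor_kernel K C B"
    using subgroup.one_closed[OF sub] by simp
  have add: "a + b \<in> tensor_kernel K C B"
    if "a \<in> tensor_kernel K C B" "b \<in> tensor_kernel K C B" for a b
    using subgroup.m_closed[OF sub that] by simp
  have mult: "frag_of p \<otimes>\<^bsub>?Z\<^esub> a \<in> tensor_kernel K C B"
       "a \<otimes>\<^bsub>?Z\<^esub> frag_of p \<in> tensor_kernel K C B"
    if "a \<in> tensor_kernel K C B" "p \<in> carrier C \<times> carrier B" for a p
  proof -
    have gen: "t \<in> tensor_kernel K C B" if "t \<in> tensor_relators K C B" for t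
      using that unfolding tensor_kernel_def by (rule generate.incl)
    have "frag_of p \<otimes>\<^bsub>?Z\<^esub> a \<in> tensor_kernel K C B \<and> a \<otimes>\<^bsub>?Z\<^esub> frag_of p \<in> tensor_kernel K C B"
      using that(1) unfolding tensor_kernel_def[of K C B]
    proof (induction a rule: generate.induct)
      case one
      then show ?case using zero by (simp add: tensor_kernel_def)
    next
      case (incl t)
      then show ?case
        using tensor_relators_mult[OF assms, of t "fst p" "snd p"] that(2) gen
        by (auto simp: tensor_kernel_def)
    next
      case (inv t)
      have "inv\<^bsub>?G\<^esub> t = 0 - t" using rel inv by auto
      then show ?case
        using tensor_relators_mult[OF assms inv, of "fst p" "snd p"] that(2) gen diff[OF zero]
        by (auto simp: int_monoid_ring_arith simp flip: tensor_kernel_def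
            simp del: diff_0)
    next
      case (eng a b)
      then show ?case
        using add by (auto simp: int_monoid_ring_add_left int_monoid_ring_add_right
            simp flip: tensor_kernel_def)
    qed
    then show "frag_of p \<otimes>\<^bsub>?Z\<^esub> a \<in> tensor_kernel K C B"
       "a \<otimes>\<^bsub>?Z\<^esub> frag_of p \<in> tensor_kernel K C B" by auto
  qed
  show ?thesis
  proof (rule idealI)
    show "ring ?Z" by (rule M.int_monoid_ring_is_ring)
    have "add_monoid ?Z = ?G"
      by (simp add: int_monoid_ring_def free_Abelian_group_def)
    then show "subgroup (tensor_kernel K C B) (add_monoid ?Z)"
      using sub by simp
  next
    fix a x assume a: "a \<in> tensor_kernel K C B" and "x \<in> carrier ?Z"
    then have x: "Poly_Mapping.keys x \<subseteq> carrier C \<times> carrier B" by simp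
    show "x \<otimes>\<^bsub>?Z\<^esub> a \<in> tensor_kernel K C B"
      using x by (induction x rule: frag_induction)
        (use a mult zero diff in \<open>auto simp: int_monoid_ring_arith\<close>)
    show "a \<otimes>\<^bsub>?Z\<^esub> x \<in> tensor_kernel K C B"
      using x by (induction x rule: frag_induction)
        (use a mult zero diff in \<open>auto simp: int_monoid_ring_arith\<close>)
  qed
qed

lemma tensor_algebra_ring_is_ring:
  assumes "ring_algebra K C" "ring_algebra K B"
  shows "ring (tensor_algebra_ring K C B)"
  unfolding tensor_algebra_ring_def
  by (rule ideal.quotient_is_ring[OF tensor_kernel_ideal[OF assms]])

lemma pure_tensor_mult:
  assumes "ring_algebra K C" "ring_algebra K B"
    and "c \<in> carrier C" "c' \<in> carrier C" "b \<in> carrier B" "b' \<in> carrier B"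
  shows "pure_tensor K C B c b \<otimes>\<^bsub>tensor_algebra_ring K C B\<^esub> pure_tensor K C B c' b' =
    pure_tensor K C B (c \<otimes>\<^bsub>C\<^esub> c') (b \<otimes>\<^bsub>B\<^esub> b')"
  using assms(3-) ideal.rcoset_mult_add[OF tensor_kernel_ideal[OF assms(1,2)],
      of "frag_of (c, b)" "frag_of (c', b')"]
  by (simp add: tensor_algebra_ring_def pure_tensor_def FactRing_def)

lemma ring_algebra_commutative:
  assumes "algebra K C"
  shows "ring_algebra K C"
proof -
  interpret C: algebra K C by fact
  have "x \<otimes>\<^bsub>C\<^esub> (k \<odot>\<^bsub>C\<^esub> y) = k \<odot>\<^bsub>C\<^esub> (x \<otimes>\<^bsub>C\<^esub> y)"
    if "k \<in> carrier K" "x \<in> carrier C" "y \<in> carrier C" for k x y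
    using that C.smult_assoc2[of k y x] by (metis C.m_comm C.smult_closed)
  then show ?thesis
    by (intro ring_algebra.intro ring_algebra_axioms.intro C.module_axioms C.ring_axioms)
      (simp_all add: C.smult_assoc2)
qed

section \<open>Left strongly Noetherian algebras\<close>

text \<open>HOL cannot quantify over all types inside a formula, so \<open>C\<close> ranges over all algebras whose
  carrier is contained in the type given by the first argument. Keeping that type a type variable
  makes it play the role of an arbitrary universe.\<close>

definition left_strongly_noetherian ::
    "'c itself \<Rightarrow> 'k ring \<Rightarrow> ('k, 'b) module \<Rightarrow> bool"
  where "left_strongly_noetherian U K B \<longleftrightarrow>
    ring_algebra K B \<and> left_noetherian_ring B \<and>
    (\<forall>C :: ('k, 'c) module. algebra K C \<and> noetherian_ring C \<longrightarrow>
      left_noetherian_ring (tensor_algebra_ring K C B))"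

section \<open>Skew PBW extensions\<close>

text \<open>Throughout, \<open>S\<close> is the carrier of the coefficient ring, as a subset of the carrier of \<open>A\<close>,
  and the generators are $x_1, \dots, x_n$.\<close>

definition exponents :: "nat \<Rightarrow> (nat \<Rightarrow> nat) set"
  where "exponents n = {1..n} \<rightarrow>\<^sub>E UNIV"

definition std_monomial :: "('a, 'm) ring_scheme \<Rightarrow> nat \<Rightarrow> (nat \<Rightarrow> 'a) \<Rightarrow> (nat \<Rightarrow> nat) \<Rightarrow> 'a"
  where "std_monomial A n x \<alpha> =
    foldr (\<lambda>i y. x i [^]\<^bsub>A\<^esub> \<alpha> i \<otimes>\<^bsub>A\<^esub> y) [1..<Suc n] \<one>\<^bsub>A\<^esub>"

text \<open>Since \<open>m\<close> is an indexed family, a basis has pairwise distinct members (unless \<open>A\<close> is the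
  zero ring).\<close>

definition left_module_basis ::
    "('a, 'm) ring_scheme \<Rightarrow> 'a set \<Rightarrow> 'i set \<Rightarrow> ('i \<Rightarrow> 'a) \<Rightarrow> bool"
  where "left_module_basis A S I m \<longleftrightarrow>
    m \<in> I \<rightarrow> carrier A \<and>
    (\<forall>a \<in> carrier A. \<exists>F r. finite F \<and> F \<subseteq> I \<and> r \<in> F \<rightarrow> S \<and>
      a = (\<Oplus>\<^bsub>A\<^esub>i\<in>F. r i \<otimes>\<^bsub>A\<^esub> m i)) \<and>
    (\<forall>F r. finite F \<and> F \<subseteq> I \<and> r \<in> F \<rightarrow> S \<and> (\<Oplus>\<^bsub>A\<^esub>i\<in>F. r i \<otimes>\<^bsub>A\<^esub> m i) = \<zero>\<^bsub>A\<^esub> \<longrightarrow>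
      (\<forall>i\<in>F. r i = \<zero>\<^bsub>A\<^esub>))"

text \<open>The set $S + S x_1 + \dots + S x_n$.\<close>

definition affine_part :: "('a, 'm) ring_scheme \<Rightarrow> 'a set \<Rightarrow> nat \<Rightarrow> (nat \<Rightarrow> 'a) \<Rightarrow> 'a set"
  where "affine_part A S n x =
    {s \<oplus>\<^bsub>A\<^esub> (\<Oplus>\<^bsub>A\<^esub>i\<in>{1..n}. r i \<otimes>\<^bsub>A\<^esub> x i) | s r. s \<in> S \<and> r \<in> {1..n} \<rightarrow> S}"

locale skew_PBW_extension = ring A + subring S A
  for A :: "('a, 'm) ring_scheme" (structure) and S :: "'a set" and n :: nat and x :: "nat \<Rightarrow> 'a" +
  assumes gens_closed: "x \<in> {1..n} \<rightarrow> carrier A"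
    and monomial_basis: "left_module_basis A S (exponents n) (std_monomial A n x)"
    and gen_coeff: "\<And>i r. \<lbrakk>i \<in> {1..n}; r \<in> S - {\<zero>}\<rbrakk> \<Longrightarrow>
        \<exists>c \<in> S - {\<zero>}. x i \<otimes> r \<ominus> c \<otimes> x i \<in> S"
    and gen_gen: "\<And>i j. \<lbrakk>i \<in> {1..n}; j \<in> {1..n}\<rbrakk> \<Longrightarrow>
        \<exists>c \<in> S - {\<zero>}. x j \<otimes> x i \<ominus> c \<otimes> (x i \<otimes> x j) \<in> affine_part A S n x"

definition skew_derivation :: "('a, 'm) ring_scheme \<Rightarrow> ('a \<Rightarrow> 'a) \<Rightarrow> ('a \<Rightarrow> 'a) \<Rightarrow> bool"
  where "skew_derivation R \<sigma> \<delta> \<longleftrightarrow>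
    \<delta> \<in> carrier R \<rightarrow> carrier R \<and>
    (\<forall>r\<in>carrier R. \<forall>s\<in>carrier R. \<delta> (r \<oplus>\<^bsub>R\<^esub> s) = \<delta> r \<oplus>\<^bsub>R\<^esub> \<delta> s) \<and>
    (\<forall>r\<in>carrier R. \<forall>s\<in>carrier R. \<delta> (r \<otimes>\<^bsub>R\<^esub> s) = \<sigma> r \<otimes>\<^bsub>R\<^esub> \<delta> s \<oplus>\<^bsub>R\<^esub> \<delta> r \<otimes>\<^bsub>R\<^esub> s)"

definition gen_twist ::
    "('a, 'm) ring_scheme \<Rightarrow> 'a set \<Rightarrow> 'a \<Rightarrow> ('a \<Rightarrow> 'a) \<Rightarrow> ('a \<Rightarrow> 'a) \<Rightarrow> bool"
  where "gen_twist A S y \<sigma> \<delta> \<longleftrightarrow>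
    \<sigma> \<in> ring_hom (A\<lparr>carrier := S\<rparr>) (A\<lparr>carrier := S\<rparr>) \<and> inj_on \<sigma> S \<and>
    skew_derivation (A\<lparr>carrier := S\<rparr>) \<sigma> \<delta> \<and>
    (\<forall>r\<in>S. y \<otimes>\<^bsub>A\<^esub> r = \<sigma> r \<otimes>\<^bsub>A\<^esub> y \<oplus>\<^bsub>A\<^esub> \<delta> r)"

text \<open>In a skew PBW extension the twist \<open>(\<sigma>\<^sub>i, \<delta>\<^sub>i)\<close> of $x_i$ exists and is unique on \<open>S\<close>, and so is
  the coefficient $c_{i,j}$ for $i < j$, both by freeness. Hence the existential quantifiers below
  pick out these data and impose only bijectivity and invertibility.\<close>

locale bijective_skew_PBW_extension = skew_PBW_extension +
  assumes twist_bijective: "\<And>i. i \<in> {1..n} \<Longrightarrow>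
      \<exists>\<sigma> \<delta>. gen_twist A S (x i) \<sigma> \<delta> \<and> bij_betw \<sigma> S S"
    and gen_gen_invertible: "\<And>i j. \<lbrakk>1 \<le> i; i < j; j \<le> n\<rbrakk> \<Longrightarrow>
      \<exists>c \<in> S - {\<zero>}. x j \<otimes> x i \<ominus> c \<otimes> (x i \<otimes> x j) \<in> affine_part A S n x \<and>
        c \<in> Units (A\<lparr>carrier := S\<rparr>)"

end

theory Submission
  imports Defs
begin

text \<open>The theorem is a Hilbert basis theorem, applied to $A$ over $R$ and to $C \otimes_K A$ over the
  image of $C \otimes_K R$. Both pairs of rings are of the same kind, captured by the locale
  \<open>almost_normalizing_extension\<close>: a ring \<open>T\<close> with a subring \<open>S\<close> and elements $x_1, \dots, x_n$ such
  that the monomials $x^\alpha = x_1^{\alpha_1} \cdots x_n^{\alpha_n}$ span \<open>T\<close> as a left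
  \<open>S\<close>-module, $x_i S \subseteq S x_i + S$, $S x_i \subseteq x_i S + S$ and
  $x_i x_j \in S x_j x_i + S + S x_1 + \dots + S x_n$ for all $i$ and $j$. In a bijective skew PBW
  extension, surjectivity of the $\sigma_i$ gives the inclusion $S x_i \subseteq x_i S + S$.

  These conditions are preserved by $C \otimes_K -$: each of them is an existence statement about
  elements, and it suffices to check it on pure tensors, where it is inherited from \<open>A\<close>
  (\<open>tensor_extension\<close>). The coefficient ring is then the image of $C \otimes_K R$ in $C \otimes_K A$,
  a quotient of a left Noetherian ring.

  For the Hilbert basis theorem (\<open>left_noetherian\<close>), order the exponents by degree, then
  lexicographically. The commutation rules cost only terms of lower degree, so a nonzero element of
  \<open>T\<close> has a leading form: it equals $x^\alpha r$ plus smaller terms, with the coefficient written on the right.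
  For a left ideal \<open>J\<close> let \<open>lead J \<alpha>\<close> be the set of all \<open>r\<close> such that $x^\alpha r$ plus smaller terms
  lies in \<open>J\<close>. Because a coefficient \<open>s\<close> can be moved across $x^\alpha$, this is a left ideal of \<open>S\<close>.
  It increases with \<open>\<alpha>\<close> in the componentwise order, since $x^{\alpha + e_i}$ is a left multiple of
  $x_i x^\alpha$ modulo lower degree (\<open>mon_raise\<close>); having the coefficients on the right makes this
  an inclusion of left ideals that involves no twist.

  If \<open>J\<close> is not finitely generated, choose $f_0, f_1, \dots$ in \<open>J\<close> such that $f_k$ has the smallest
  possible leading exponent among the elements outside the left ideal generated by its predecessors.
  By Dickson's lemma one can pass to a subsequence with increasing exponents, and as \<open>S\<close> is left
  Noetherian some leading coefficient $r_m$ of it lies in the left ideal generated by the previous ones.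
  Hence $r_m$ is a leading coefficient, at the exponent of $f_m$, of an element of the ideal generated
  by the predecessors of $f_m$. Subtracting that element from $f_m$ contradicts minimality.\<close>

section \<open>Left ideals and left Noetherian rings\<close>

lemma (in ring) left_idealI:
  assumes "I \<subseteq> carrier R" and "\<zero> \<in> I"
    and "\<And>a b. \<lbrakk>a \<in> I; b \<in> I\<rbrakk> \<Longrightarrow> a \<oplus> b \<in> I"
    and mult: "\<And>r a. \<lbrakk>r \<in> carrier R; a \<in> I\<rbrakk> \<Longrightarrow> r \<otimes> a \<in> I"
  shows "left_ideal I R"
proof -
  have "\<ominus> a \<in> I" if "a \<in> I" for a
    using mult[of "\<ominus> \<one>" a] that assms(1) by (auto simp: l_minus subset_iff)
  then have "subgroup I (add_monoid R)"
    using assms by (intro add.subgroupI) (auto simp: a_inv_def)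
  then show ?thesis
    using ring_axioms mult
    by (simp add: left_ideal_def additive_subgroup_def left_ideal_axioms_def)
qed

lemma left_idealD:
  assumes "left_ideal I R"
  shows "I \<subseteq> carrier R" and "\<zero>\<^bsub>R\<^esub> \<in> I"
    and "\<And>a b. \<lbrakk>a \<in> I; b \<in> I\<rbrakk> \<Longrightarrow> a \<oplus>\<^bsub>R\<^esub> b \<in> I"
    and "\<And>a b. \<lbrakk>a \<in> I; b \<in> I\<rbrakk> \<Longrightarrow> a \<ominus>\<^bsub>R\<^esub> b \<in> I"
    and "\<And>r a. \<lbrakk>r \<in> carrier R; a \<in> I\<rbrakk> \<Longrightarrow> r \<otimes>\<^bsub>R\<^esub> a \<in> I"
proof -
  interpret left_ideal I R by fact
  show "I \<subseteq> carrier R" "\<zero>\<^bsub>R\<^esub> \<in> I" using a_subset zero_closed by auto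
  show "a \<oplus>\<^bsub>R\<^esub> b \<in> I" "a \<ominus>\<^bsub>R\<^esub> b \<in> I" if "a \<in> I" "b \<in> I" for a b
    using that by (auto simp: a_minus_def)
  show "r \<otimes>\<^bsub>R\<^esub> a \<in> I" if "r \<in> carrier R" "a \<in> I" for r a
    using that by (rule left_closed[rotated])
qed

lemma (in ring) left_ideal_carrier: "left_ideal (carrier R) R"
  by (rule left_idealI) auto

lemma gen_left_ideal_incl: "F \<subseteq> gen_left_ideal R F"
  by (auto simp: gen_left_ideal_def)

lemma gen_left_ideal_least: "\<lbrakk>left_ideal I R; F \<subseteq> I\<rbrakk> \<Longrightarrow> gen_left_ideal R F \<subseteq> I"
  by (auto simp: gen_left_ideal_def)

lemma (in ring) left_ideal_gen_left_ideal:
  assumes "F \<subseteq> carrier R"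
  shows "left_ideal (gen_left_ideal R F) R"
proof (rule left_idealI)
  show "gen_left_ideal R F \<subseteq> carrier R"
    by (rule gen_left_ideal_least[OF left_ideal_carrier assms])
next
  show "\<zero> \<in> gen_left_ideal R F"
    unfolding gen_left_ideal_def using left_idealD(2) by blast
next
  fix a b assume "a \<in> gen_left_ideal R F" "b \<in> gen_left_ideal R F"
  then show "a \<oplus> b \<in> gen_left_ideal R F"
    unfolding gen_left_ideal_def by (simp add: left_idealD(3)[of _ R])
next
  fix r a assume "r \<in> carrier R" "a \<in> gen_left_ideal R F"
  then show "r \<otimes> a \<in> gen_left_ideal R F"
    unfolding gen_left_ideal_def by (simp add: left_idealD(5)[of _ R])
qed

lemma (in ring) gen_left_ideal_mono:
  assumes "F \<subseteq> G" "G \<subseteq> carrier R"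
  shows "gen_left_ideal R F \<subseteq> gen_left_ideal R G"
  by (rule gen_left_ideal_least[OF left_ideal_gen_left_ideal[OF assms(2)]])
    (rule subset_trans[OF assms(1) gen_left_ideal_incl])

text \<open>The ascending chain condition in the form used below: the left ideals generated by the initial
  segments of a sequence exhaust a left ideal, and finitely many generators of it already lie in one of
  them.\<close>

lemma (in left_noetherian_ring) sequence_redundant:
  assumes r: "range r \<subseteq> carrier R"
  shows "\<exists>m. r m \<in> gen_left_ideal R (r ` {..<m::nat})"
proof -
  let ?J = "\<lambda>m. gen_left_ideal R (r ` {..<m})"
  let ?U = "\<Union>m. ?J m"
  have ideal: "left_ideal (?J m) R" for m
    by (rule left_ideal_gen_left_ideal) (use r in auto)
  have mono: "?J k \<subseteq> ?J m" if "k \<le> m" for k m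
    by (rule gen_left_ideal_mono) (use r that in auto)
  have "left_ideal ?U R"
  proof (rule left_idealI)
    fix a b assume "a \<in> ?U" "b \<in> ?U"
    then obtain k l where "a \<in> ?J k" "b \<in> ?J l" by auto
    then have "a \<in> ?J (max k l)" "b \<in> ?J (max k l)"
      using mono[of k "max k l"] mono[of l "max k l"] by auto
    then show "a \<oplus> b \<in> ?U" using left_idealD(3)[OF ideal] by blast
  next
    show "?U \<subseteq> carrier R" using left_idealD(1)[OF ideal] by blast
    show "\<zero> \<in> ?U" using left_idealD(2)[OF ideal] by blast
  next
    fix s a assume "s \<in> carrier R" "a \<in> ?U"
    then show "s \<otimes> a \<in> ?U" using left_idealD(5)[OF ideal] by blast
  qed
  then obtain F where F: "finite F" "?U = gen_left_ideal R F"
    using left_finitely_gen by blast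
  have "\<exists>m. G \<subseteq> ?J m" if "finite G" "G \<subseteq> ?U" for G
    using that
  proof (induction G)
    case (insert g G)
    then obtain k l where "g \<in> ?J k" "G \<subseteq> ?J l" by auto
    then show ?case
      using mono[of k "max k l"] mono[of l "max k l"] by (intro exI[of _ "max k l"]) auto
  qed simp
  then obtain m where "F \<subseteq> ?J m"
    using F gen_left_ideal_incl[of F R] by metis
  then have "?U \<subseteq> ?J m"
    unfolding F(2) by (rule gen_left_ideal_least[OF ideal])
  moreover have "r m \<in> ?J (Suc m)" using gen_left_ideal_incl[of "r ` {..<Suc m}" R] by auto
  ultimately show ?thesis by blast
qed

text \<open>The preimage of a left ideal is finitely generated, and the images of its generators generate.\<close>

lemma left_noetherian_ring_image:
  assumes P: "left_noetherian_ring P" and "ring_hom_ring P Q h"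
    and surj: "h ` carrier P = carrier Q"
  shows "left_noetherian_ring Q"
proof -
  interpret P: left_noetherian_ring P by fact
  interpret h: ring_hom_ring P Q h by fact
  have preimage: "left_ideal {a \<in> carrier P. h a \<in> J} P" if J: "left_ideal J Q" for J
  proof (rule P.left_idealI)
    show "\<zero>\<^bsub>P\<^esub> \<in> {a \<in> carrier P. h a \<in> J}"
      using left_idealD(2)[OF J] by simp
    show "a \<oplus>\<^bsub>P\<^esub> b \<in> {a \<in> carrier P. h a \<in> J}"
      if "a \<in> {a \<in> carrier P. h a \<in> J}" "b \<in> {a \<in> carrier P. h a \<in> J}" for a b
      using that left_idealD(3)[OF J, of "h a" "h b"] by simp
    show "r \<otimes>\<^bsub>P\<^esub> a \<in> {a \<in> carrier P. h a \<in> J}"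
      if "r \<in> carrier P" "a \<in> {a \<in> carrier P. h a \<in> J}" for r a
      using that left_idealD(5)[OF J, of "h r" "h a"] by simp
  qed blast
  have "\<exists>F \<subseteq> carrier Q. finite F \<and> J = gen_left_ideal Q F" if J: "left_ideal J Q" for J
  proof -
    let ?I = "{a \<in> carrier P. h a \<in> J}"
    obtain F where F: "F \<subseteq> carrier P" "finite F" "?I = gen_left_ideal P F"
      using P.left_finitely_gen[OF preimage[OF J]] by blast
    have hF: "h ` F \<subseteq> carrier Q" using F(1) by auto
    note gen = h.S.left_ideal_gen_left_ideal[OF hF]
    have "F \<subseteq> {a \<in> carrier P. h a \<in> gen_left_ideal Q (h ` F)}"
      using F(1) gen_left_ideal_incl[of "h ` F" Q] by blast
    then have "?I \<subseteq> {a \<in> carrier P. h a \<in> gen_left_ideal Q (h ` F)}"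
      unfolding F(3) by (rule gen_left_ideal_least[OF preimage[OF gen]])
    moreover have "J \<subseteq> h ` ?I"
      using left_idealD(1)[OF J] unfolding surj[symmetric] by blast
    ultimately have "J \<subseteq> gen_left_ideal Q (h ` F)" by blast
    moreover have "F \<subseteq> ?I" unfolding F(3) by (rule gen_left_ideal_incl)
    then have "gen_left_ideal Q (h ` F) \<subseteq> J"
      by (intro gen_left_ideal_least[OF J]) auto
    ultimately show ?thesis using hF F(2) by (intro exI[of _ "h ` F"]) auto
  qed
  then show ?thesis
    by (simp add: left_noetherian_ring_def left_noetherian_ring_axioms_def h.S.ring_axioms)
qed

section \<open>Left spans over a subring\<close>

inductive_set left_span :: "('a, 'm) ring_scheme \<Rightarrow> 'a set \<Rightarrow> 'a set \<Rightarrow> 'a set"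
  for R (structure) and S M
  where
    zero: "\<zero> \<in> left_span R S M"
  | add: "\<lbrakk>s \<in> S; m \<in> M; v \<in> left_span R S M\<rbrakk> \<Longrightarrow> s \<otimes> m \<oplus> v \<in> left_span R S M"

locale ring_with_subring = ring R + subring S R for R (structure) and S
begin

lemma subring_elem: "s \<in> S \<Longrightarrow> s \<in> carrier R"
  using subset by auto

lemma left_span_carrier:
  assumes "M \<subseteq> carrier R" "v \<in> left_span R S M"
  shows "v \<in> carrier R"
  using assms(2) by induction (use assms(1) subring_elem in auto)

lemma left_span_incl:
  assumes "M \<subseteq> carrier R" "m \<in> M"
  shows "m \<in> left_span R S M"
  using left_span.add[where s = \<one> and S = S and m = m and M = M and v = \<zero> and R = R] assms left_span.zero[of R S M] by auto

lemma left_span_add: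
  assumes "M \<subseteq> carrier R" "u \<in> left_span R S M" "v \<in> left_span R S M"
  shows "u \<oplus> v \<in> left_span R S M"
  using assms(2)
proof induction
  case (add s m u)
  have "s \<otimes> m \<oplus> u \<oplus> v = s \<otimes> m \<oplus> (u \<oplus> v)"
    using add assms left_span_carrier[OF assms(1)] subring_elem by (intro a_assoc) auto
  then show ?case using left_span.add[OF add(1,2,4)] by simp
qed (use assms left_span_carrier in auto)

lemma left_span_smult:
  assumes "M \<subseteq> carrier R" "s \<in> S" "v \<in> left_span R S M"
  shows "s \<otimes> v \<in> left_span R S M"
  using assms(3)
proof induction
  case (add t m u)
  have "s \<otimes> (t \<otimes> m \<oplus> u) = (s \<otimes> t) \<otimes> m \<oplus> s \<otimes> u"
    using add assms left_span_carrier[OF assms(1)] subring_elem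
    by (subst r_distr) (auto simp: m_assoc)
  moreover have "s \<otimes> t \<in> S" using assms(2) add(1) by simp
  ultimately show ?case using left_span.add[of "s \<otimes> t" S m M _ R] add by simp
qed (use assms subring_elem left_span.zero in auto)

lemma left_span_minus:
  assumes "M \<subseteq> carrier R" "u \<in> left_span R S M" "v \<in> left_span R S M"
  shows "u \<ominus> v \<in> left_span R S M"
proof -
  have "\<ominus> \<one> \<in> S" using m_inv_closed[of \<one>] by (simp add: a_inv_def)
  from left_span_smult[OF assms(1) this assms(3)]
  have "\<ominus> v \<in> left_span R S M"
    using left_span_carrier[OF assms(1,3)] by (simp add: l_minus)
  then show ?thesis using left_span_add[OF assms(1,2)] by (simp add: a_minus_def)
qed

lemma left_span_mono:
  assumes "M \<subseteq> N"
  shows "left_span R S M \<subseteq> left_span R S N"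
proof
  show "v \<in> left_span R S N" if "v \<in> left_span R S M" for v
    using that by induction (use assms in \<open>auto intro: left_span.intros\<close>)
qed

lemma left_span_finsum:
  assumes "M \<subseteq> carrier R" "finite I" "\<And>i. i \<in> I \<Longrightarrow> f i \<in> left_span R S M"
  shows "(\<Oplus>i\<in>I. f i) \<in> left_span R S M"
  using assms(2,3)
proof (induction I)
  case (insert i I)
  then show ?case
    using left_span_carrier[OF assms(1)] left_span_add[OF assms(1)]
    by (subst finsum_insert) auto
qed (simp add: left_span.zero)

end

section \<open>Exponent vectors\<close>

definition total_degree :: "nat \<Rightarrow> (nat \<Rightarrow> nat) \<Rightarrow> nat"
  where "total_degree n \<alpha> = (\<Sum>i\<in>{1..n}. \<alpha> i)"

definition raise :: "(nat \<Rightarrow> nat) \<Rightarrow> nat \<Rightarrow> nat \<Rightarrow> nat"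
  where "raise \<alpha> i = \<alpha>(i := Suc (\<alpha> i))"

definition deglex :: "nat \<Rightarrow> (nat \<Rightarrow> nat) \<Rightarrow> (nat \<Rightarrow> nat) \<Rightarrow> bool"
  where "deglex n \<alpha> \<beta> \<longleftrightarrow> total_degree n \<alpha> < total_degree n \<beta> \<or>
    total_degree n \<alpha> = total_degree n \<beta> \<and> (\<exists>k\<in>{1..n}. \<alpha> k < \<beta> k \<and> (\<forall>i\<in>{1..<k}. \<alpha> i = \<beta> i))"

lemma raise_apply: "raise \<alpha> i k = (if k = i then Suc (\<alpha> i) else \<alpha> k)"
  by (simp add: raise_def)

lemma raise_commute: "raise (raise \<alpha> i) j = raise (raise \<alpha> j) i"
  by (auto simp: raise_apply fun_eq_iff)

lemma raise_exponents: "\<lbrakk>\<alpha> \<in> exponents n; i \<in> {1..n}\<rbrakk> \<Longrightarrow> raise \<alpha> i \<in> exponents n"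
  by (auto simp: raise_apply exponents_def PiE_def extensional_def)

lemma total_degree_raise: "i \<in> {1..n} \<Longrightarrow> total_degree n (raise \<alpha> i) = Suc (total_degree n \<alpha>)"
proof -
  assume i: "i \<in> {1..n}"
  have "(\<Sum>k\<in>{1..n} - {i}. raise \<alpha> i k) = (\<Sum>k\<in>{1..n} - {i}. \<alpha> k)"
    by (rule sum.cong) (auto simp: raise_apply)
  then show ?thesis
    using i sum.remove[of "{1..n}" i \<alpha>] sum.remove[of "{1..n}" i "raise \<alpha> i"]
    by (simp add: total_degree_def raise_apply)
qed

text \<open>An exponent other than $0$ is raised at its first nonzero position $j$. There the monomial is
  $x_j$ times a smaller standard monomial without reordering, so the step starts from an exact product.
  The hypothesis covers all exponents of smaller degree because straightening produces such terms.\<close>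

lemma exponents_induct [consumes 1, case_names zero raise]:
  assumes "\<alpha> \<in> exponents n"
    and zero: "P (\<lambda>i\<in>{1..n}. 0)"
    and raise: "\<And>j \<alpha>. \<lbrakk>j \<in> {1..n}; \<alpha> \<in> exponents n; \<forall>k\<in>{1..<j}. \<alpha> k = 0;
      \<And>\<beta>. \<lbrakk>\<beta> \<in> exponents n; total_degree n \<beta> \<le> total_degree n \<alpha>\<rbrakk> \<Longrightarrow> P \<beta>\<rbrakk> \<Longrightarrow> P (raise \<alpha> j)"
  shows "P \<alpha>"
  using assms(1)
proof (induction "total_degree n \<alpha>" arbitrary: \<alpha> rule: less_induct)
  case less
  show ?case
  proof (cases "\<exists>j. j \<in> {1..n} \<and> \<alpha> j \<noteq> 0")
    case False
    then have "\<alpha> = (\<lambda>i\<in>{1..n}. 0)"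
      using less.prems by (intro extensionalityI) (auto simp: exponents_def PiE_def)
    then show ?thesis using zero by simp
  next
    case True
    define j where "j = (LEAST j. j \<in> {1..n} \<and> \<alpha> j \<noteq> 0)"
    have j: "j \<in> {1..n}" "\<alpha> j \<noteq> 0"
      using LeastI_ex[OF True] by (auto simp: j_def)
    have least: "\<alpha> k = 0" if "k \<in> {1..<j}" for k
      using not_less_Least[of k "\<lambda>j. j \<in> {1..n} \<and> \<alpha> j \<noteq> 0", folded j_def] that j by auto
    define \<beta> where "\<beta> = \<alpha>(j := \<alpha> j - 1)"
    have \<alpha>: "\<alpha> = raise \<beta> j" using j by (auto simp: \<beta>_def raise_def)
    have \<beta>: "\<beta> \<in> exponents n"
      using less.prems j by (auto simp: \<beta>_def exponents_def PiE_def extensional_def)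
    have "P (raise \<beta> j)"
    proof (rule raise[OF j(1) \<beta>])
      show "\<forall>k\<in>{1..<j}. \<beta> k = 0" using least by (simp add: \<beta>_def)
      show "P \<gamma>" if "\<gamma> \<in> exponents n" "total_degree n \<gamma> \<le> total_degree n \<beta>" for \<gamma>
        using that less.hyps[of \<gamma>] total_degree_raise[OF j(1), of \<beta>] \<alpha> by simp
    qed
    then show ?thesis using \<alpha> by simp
  qed
qed

lemma deglex_trans:
  assumes "deglex n \<alpha> \<beta>" "deglex n \<beta> \<gamma>"
  shows "deglex n \<alpha> \<gamma>"
proof (cases "total_degree n \<alpha> = total_degree n \<beta> \<and> total_degree n \<beta> = total_degree n \<gamma>")
  case True
  then obtain k l where k: "k \<in> {1..n}" "\<alpha> k < \<beta> k" "\<forall>i\<in>{1..<k}. \<alpha> i = \<beta> i"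
    and l: "l \<in> {1..n}" "\<beta> l < \<gamma> l" "\<forall>i\<in>{1..<l}. \<beta> i = \<gamma> i"
    using assms unfolding deglex_def by auto
  have "min k l \<in> {1..n} \<and> \<alpha> (min k l) < \<gamma> (min k l) \<and> (\<forall>i\<in>{1..<min k l}. \<alpha> i = \<gamma> i)"
    using k l by (cases k l rule: linorder_cases) auto
  then show ?thesis using True unfolding deglex_def by metis
qed (use assms in \<open>auto simp: deglex_def\<close>)

lemma deglex_total:
  assumes "\<alpha> \<in> exponents n" "\<beta> \<in> exponents n" "\<alpha> \<noteq> \<beta>"
  shows "deglex n \<alpha> \<beta> \<or> deglex n \<beta> \<alpha>"
proof -
  have ex: "\<exists>k. k \<in> {1..n} \<and> \<alpha> k \<noteq> \<beta> k"
    using assms PiE_ext[of \<alpha> "{1..n}" "\<lambda>_. UNIV" \<beta>] unfolding exponents_def by blast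
  define k where "k = (LEAST k. k \<in> {1..n} \<and> \<alpha> k \<noteq> \<beta> k)"
  have k: "k \<in> {1..n}" "\<alpha> k \<noteq> \<beta> k"
    using LeastI_ex[OF ex] by (auto simp: k_def)
  have least: "\<forall>i\<in>{1..<k}. \<alpha> i = \<beta> i"
  proof
    fix i assume "i \<in> {1..<k}"
    then show "\<alpha> i = \<beta> i"
      using not_less_Least[of i "\<lambda>k. k \<in> {1..n} \<and> \<alpha> k \<noteq> \<beta> k", folded k_def] k by auto
  qed
  then have "\<forall>i\<in>{1..<k}. \<beta> i = \<alpha> i" by simp
  with least k show ?thesis
    unfolding deglex_def by (metis linorder_neqE_nat)
qed

text \<open>The order is the lexicographic one on the lists $(|\alpha|, \alpha_1, \dots, \alpha_n)$ of
  constant length.\<close>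

lemma wf_deglex: "wf {(\<alpha>, \<beta>). deglex n \<alpha> \<beta>}"
proof (rule wf_subset)
  let ?key = "\<lambda>\<alpha>. total_degree n \<alpha> # map \<alpha> [1..<Suc n]"
  show "wf (inv_image (lexn less_than (Suc n)) ?key)"
    by (intro wf_inv_image wf_lexn wf_less_than)
  have "(?key \<alpha>, ?key \<beta>) \<in> lexn less_than (Suc n)" if "deglex n \<alpha> \<beta>" for \<alpha> \<beta>
  proof (cases "total_degree n \<alpha> < total_degree n \<beta>")
    case True
    then show ?thesis 
      unfolding lexn_conv mem_Collect_eq case_prod_conv
      by (intro conjI, simp, simp, rule_tac exI[of _ "[]"], simp del: upt_Suc)
  next
    case False
    then obtain k where deg: "total_degree n \<alpha> = total_degree n \<beta>"
      and k: "k \<in> {1..n}" "\<alpha> k < \<beta> k" "\<forall>i\<in>{1..<k}. \<alpha> i = \<beta> i"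
      using \<open>deglex n \<alpha> \<beta>\<close> unfolding deglex_def by auto
    have upt_split: "[1..<Suc n] = [1..<k] @ k # [Suc k..<Suc n]"
      using k(1) upt_add_eq_append[of 1 k "Suc n - k"] upt_conv_Cons[of k "Suc n"] by auto
    have "map \<alpha> [1..<k] = map \<beta> [1..<k]" using k(3) by simp
    then show ?thesis
      using k(2) deg unfolding lexn_conv mem_Collect_eq case_prod_conv
      by (intro conjI, simp, simp, rule_tac exI[of _ "total_degree n \<alpha> # map \<alpha> [1..<k]"])
        (simp add: upt_split[unfolded One_nat_def] del: upt_Suc)
  qed
  then show "{(\<alpha>, \<beta>). deglex n \<alpha> \<beta>} \<subseteq> inv_image (lexn less_than (Suc n)) ?key"
    by auto
qed

lemma deglex_raise:
  assumes "deglex n \<alpha> \<beta>" "i \<in> {1..n}"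
  shows "deglex n (raise \<alpha> i) (raise \<beta> i)"
proof (cases "total_degree n \<alpha> < total_degree n \<beta>")
  case False
  then obtain k where "total_degree n \<alpha> = total_degree n \<beta>"
    and "k \<in> {1..n}" "\<alpha> k < \<beta> k" "\<forall>i\<in>{1..<k}. \<alpha> i = \<beta> i"
    using assms(1) unfolding deglex_def by auto
  then show ?thesis
    unfolding deglex_def using total_degree_raise[OF assms(2)]
    by (intro disjI2 conjI bexI[of _ k]) (auto simp: raise_apply)
qed (simp add: deglex_def total_degree_raise[OF assms(2)])

text \<open>The positions where the sequence takes the minimum of its tail are cofinal, and along them it
  increases.\<close>

lemma nat_sequence_monotone_subsequence:
  fixes a :: "nat \<Rightarrow> nat"
  shows "\<exists>\<phi> :: nat \<Rightarrow> nat. strict_mono \<phi> \<and> mono (a \<circ> \<phi>)"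
proof -
  let ?good = "{k. \<forall>j\<ge>k. a k \<le> a j}"
  have "\<exists>k\<ge>N. k \<in> ?good" for N
  proof -
    obtain k where k: "k \<ge> N" "\<And>j. j \<ge> N \<Longrightarrow> a k \<le> a j"
      using ex_has_least_nat[of "\<lambda>k. k \<ge> N" N a] by auto
    then show ?thesis by (intro exI[of _ k]) auto
  qed
  then have inf: "infinite ?good"
    unfolding infinite_nat_iff_unbounded_le by auto
  let ?\<phi> = "enumerate ?good"
  have "strict_mono ?\<phi>" by (rule strict_mono_enumerate[OF inf])
  moreover have "mono (a \<circ> ?\<phi>)"
    using enumerate_in_set[OF inf] strict_mono_less_eq[OF \<open>strict_mono ?\<phi>\<close>]
    by (auto simp: mono_def)
  ultimately show ?thesis by blast
qed

text \<open>Dickson's lemma for sequences: thin out the sequence one coordinate at a time.\<close>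

lemma dickson_monotone_subsequence:
  fixes a :: "nat \<Rightarrow> nat \<Rightarrow> nat"
  assumes "finite F"
  shows "\<exists>\<phi> :: nat \<Rightarrow> nat. strict_mono \<phi> \<and> (\<forall>i\<in>F. mono (\<lambda>k. a (\<phi> k) i))"
  using assms
proof (induction F)
  case empty
  then show ?case by (intro exI[of _ id]) (auto simp: strict_mono_def)
next
  case (insert i F)
  then obtain \<phi> :: "nat \<Rightarrow> nat" where \<phi>: "strict_mono \<phi>" "\<forall>i\<in>F. mono (\<lambda>k. a (\<phi> k) i)" by blast
  obtain \<psi> :: "nat \<Rightarrow> nat" where \<psi>: "strict_mono \<psi>" "mono ((\<lambda>k. a (\<phi> k) i) \<circ> \<psi>)"
    using nat_sequence_monotone_subsequence by blast
  have "mono (\<lambda>k. a (\<phi> (\<psi> k)) l)" if "l \<in> F" for l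
    using \<phi>(2) that strict_mono_mono[OF \<psi>(1)] by (auto simp: mono_def)
  then show ?case
    using \<phi>(1) \<psi> by (intro exI[of _ "\<phi> \<circ> \<psi>"]) (auto simp: strict_mono_def mono_def)
qed

section \<open>Straightening products of generators\<close>

text \<open>Coefficients are only asserted to exist, which is the form that passes to tensor products. Each
  rule moves a generator past a coefficient or another generator at the price of terms of smaller
  degree.\<close>

locale almost_normalizing_extension = ring_with_subring R S
  for R :: "('a, 'm) ring_scheme" (structure) and S :: "'a set" and n :: nat and x :: "nat \<Rightarrow> 'a" +
  assumes gens_closed: "i \<in> {1..n} \<Longrightarrow> x i \<in> carrier R"
    and spanning: "carrier R \<subseteq> left_span R S (std_monomial R n x ` exponents n)"
    and gen_past_coeff: "\<lbrakk>i \<in> {1..n}; s \<in> S\<rbrakk> \<Longrightarrow> \<exists>s'\<in>S. \<exists>t\<in>S. x i \<otimes> s = s' \<otimes> x i \<oplus> t"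
    and coeff_past_gen: "\<lbrakk>i \<in> {1..n}; s \<in> S\<rbrakk> \<Longrightarrow> \<exists>s'\<in>S. \<exists>t\<in>S. s \<otimes> x i = x i \<otimes> s' \<oplus> t"
    and gen_past_gen: "\<lbrakk>i \<in> {1..n}; j \<in> {1..n}\<rbrakk> \<Longrightarrow>
      \<exists>c\<in>S. \<exists>a\<in>left_span R S (insert \<one> (x ` {1..n})). x i \<otimes> x j = c \<otimes> (x j \<otimes> x i) \<oplus> a"
begin

abbreviation mon :: "(nat \<Rightarrow> nat) \<Rightarrow> 'a"
  where "mon \<equiv> std_monomial R n x"

text \<open>The predicate selects the exponents. The two instances that matter are the filtration by degree
  and the terms below a given exponent.\<close>

definition span_on :: "((nat \<Rightarrow> nat) \<Rightarrow> bool) \<Rightarrow> 'a set"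
  where "span_on P = left_span R S (mon ` {\<alpha> \<in> exponents n. P \<alpha>})"

abbreviation filt :: "nat \<Rightarrow> 'a set"
  where "filt d \<equiv> span_on (\<lambda>\<alpha>. total_degree n \<alpha> < d)"

abbreviation lower :: "(nat \<Rightarrow> nat) \<Rightarrow> 'a set"
  where "lower \<alpha> \<equiv> span_on (\<lambda>\<beta>. deglex n \<beta> \<alpha>)"

lemma foldr_powers_closed:
  fixes \<alpha> :: "nat \<Rightarrow> nat"
  assumes "set ks \<subseteq> {1..n}" "y \<in> carrier R"
  shows "foldr (\<lambda>i y. x i [^] \<alpha> i \<otimes> y) ks y \<in> carrier R"
  using assms(1) by (induction ks) (auto simp: assms(2) gens_closed)

lemma mon_closed: "mon \<alpha> \<in> carrier R"
  unfolding std_monomial_def by (rule foldr_powers_closed) auto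

lemma mon_zero: "mon (\<lambda>i\<in>{1..n}. 0) = \<one>"
proof -
  have "foldr (\<lambda>i y. x i [^] (\<lambda>i\<in>{1..n}. 0::nat) i \<otimes> y) ks \<one> = \<one>" if "set ks \<subseteq> {1..n}" for ks
    using that by (induction ks) auto
  then show ?thesis
    unfolding std_monomial_def
    by (metis atLeastLessThanSuc_atLeastAtMost atLeastLessThan_upt order_refl)
qed

text \<open>No reordering is involved: the factors of $x^\alpha$ to the left of $x_i$ are trivial.\<close>

lemma gen_mult_mon_exact:
  assumes i: "i \<in> {1..n}" and zeros: "\<forall>k\<in>{1..<i}. \<alpha> k = 0"
  shows "x i \<otimes> mon \<alpha> = mon (raise \<alpha> i)"
proof -
  have upt_split: "[1..<Suc n] = [1..<i] @ i # [Suc i..<Suc n]"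
    using i upt_add_eq_append[of 1 i "Suc n - i"] upt_conv_Cons[of i "Suc n"] by auto
  have skip: "foldr (\<lambda>k y. x k [^] \<beta> k \<otimes> y) ks y = y"
    if "set ks \<subseteq> {1..<i}" "\<forall>k\<in>{1..<i}. \<beta> k = 0" "y \<in> carrier R" for \<beta> :: "nat \<Rightarrow> nat" and ks y
    using that(1) by (induction ks) (use that i in auto)
  let ?tail = "\<lambda>\<beta>. foldr (\<lambda>k y. x k [^] \<beta> k \<otimes> y) [Suc i..<Suc n] \<one>"
  have tail: "?tail \<beta> \<in> carrier R" for \<beta> :: "nat \<Rightarrow> nat"
    by (rule foldr_powers_closed) auto
  have xi: "x i \<in> carrier R" by (rule gens_closed[OF i])
  have mon: "mon \<beta> = x i [^] \<beta> i \<otimes> ?tail \<beta>" if "\<forall>k\<in>{1..<i}. \<beta> k = 0" for \<beta>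
    unfolding std_monomial_def upt_split foldr_append
    by (subst skip) (use that tail xi in \<open>auto simp del: upt_Suc\<close>)
  have "?tail (raise \<alpha> i) = ?tail \<alpha>"
    by (rule foldr_cong) (auto simp: raise_apply)
  then show ?thesis
    using mon[OF zeros] mon[of "raise \<alpha> i"] zeros xi tail nat_pow_Suc2[OF xi, of "\<alpha> i"]
    by (simp add: raise_apply del: upt_Suc nat_pow_Suc flip: m_assoc)
qed

lemma mon_set_closed: "mon ` A \<subseteq> carrier R"
  using mon_closed by auto

lemma span_on_closed: "v \<in> span_on P \<Longrightarrow> v \<in> carrier R"
  unfolding span_on_def by (rule left_span_carrier[OF mon_set_closed])

lemma span_on_zero: "\<zero> \<in> span_on P"
  unfolding span_on_def by (rule left_span.zero)

lemma span_on_mon: "\<lbrakk>\<alpha> \<in> exponents n; P \<alpha>\<rbrakk> \<Longrightarrow> mon \<alpha> \<in> span_on P"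
  unfolding span_on_def by (rule left_span_incl[OF mon_set_closed]) auto

lemma span_on_add: "\<lbrakk>u \<in> span_on P; v \<in> span_on P\<rbrakk> \<Longrightarrow> u \<oplus> v \<in> span_on P"
  unfolding span_on_def by (rule left_span_add[OF mon_set_closed])

lemma span_on_minus: "\<lbrakk>u \<in> span_on P; v \<in> span_on P\<rbrakk> \<Longrightarrow> u \<ominus> v \<in> span_on P"
  unfolding span_on_def by (rule left_span_minus[OF mon_set_closed])

lemma span_on_smult: "\<lbrakk>s \<in> S; v \<in> span_on P\<rbrakk> \<Longrightarrow> s \<otimes> v \<in> span_on P"
  unfolding span_on_def by (rule left_span_smult[OF mon_set_closed])

lemma span_on_mono:
  assumes "\<And>\<alpha>. \<lbrakk>\<alpha> \<in> exponents n; P \<alpha>\<rbrakk> \<Longrightarrow> Q \<alpha>"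
  shows "v \<in> span_on P \<Longrightarrow> v \<in> span_on Q"
  unfolding span_on_def using left_span_mono[OF image_mono] assms
  by (metis (mono_tags, lifting) Collect_mono subsetD)

lemma span_on_induct [consumes 1, case_names zero mon add]:
  assumes "v \<in> span_on P"
    and zero: "Q \<zero>"
    and mon: "\<And>s \<alpha>. \<lbrakk>s \<in> S; \<alpha> \<in> exponents n; P \<alpha>\<rbrakk> \<Longrightarrow> Q (s \<otimes> mon \<alpha>)"
    and add: "\<And>u v. \<lbrakk>u \<in> span_on P; v \<in> span_on P; Q u; Q v\<rbrakk> \<Longrightarrow> Q (u \<oplus> v)"
  shows "Q v"
  using assms(1) unfolding span_on_def
proof (induction rule: left_span.induct)
  case (add s m v)
  then obtain \<alpha> where \<alpha>: "\<alpha> \<in> exponents n" "P \<alpha>" "m = mon \<alpha>" by auto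
  show ?case
    unfolding \<alpha>(3)
  proof (rule assms(4))
    show "s \<otimes> mon \<alpha> \<in> span_on P"
      by (intro span_on_smult span_on_mon add.hyps(1) \<alpha>)
    show "v \<in> span_on P" using add.hyps(3) unfolding span_on_def .
  qed (use add \<alpha> mon in auto)
qed (rule zero)

lemma carrier_span_on: "a \<in> carrier R \<Longrightarrow> a \<in> span_on (\<lambda>_. True)"
  using spanning by (auto simp: span_on_def)

text \<open>An exact equality, in the shape of the straightening rules below.\<close>

lemma unit_multiple_form:
  assumes "b \<in> carrier R" "a = b"
  shows "\<exists>s\<in>S. \<exists>v\<in>span_on P. a = s \<otimes> b \<oplus> v"
proof (rule bexI)
  show "\<exists>v\<in>span_on P. a = \<one> \<otimes> b \<oplus> v"
    by (rule bexI[OF _ span_on_zero]) (use assms in simp)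
qed simp

lemmas closed = gens_closed mon_closed span_on_closed subring_elem

text \<open>A coefficient in front of a monomial is moved past $x_i$ first, which leaves a multiple of the
  monomial itself; hence the inclusion of \<open>P\<close> in \<open>Q\<close>.\<close>

lemma gen_mult_span:
  assumes "v \<in> span_on P" "i \<in> {1..n}"
    and "\<And>\<alpha>. \<lbrakk>\<alpha> \<in> exponents n; P \<alpha>\<rbrakk> \<Longrightarrow> x i \<otimes> mon \<alpha> \<in> span_on Q"
    and PQ: "\<And>\<alpha>. \<lbrakk>\<alpha> \<in> exponents n; P \<alpha>\<rbrakk> \<Longrightarrow> Q \<alpha>"
  shows "x i \<otimes> v \<in> span_on Q"
  using assms(1)
proof (induction rule: span_on_induct)
  case (mon s \<alpha>)
  obtain s' t where st: "s' \<in> S" "t \<in> S" "x i \<otimes> s = s' \<otimes> x i \<oplus> t"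
    using gen_past_coeff[OF assms(2) mon(1)] by blast
  have "x i \<otimes> (s \<otimes> mon \<alpha>) = s' \<otimes> (x i \<otimes> mon \<alpha>) \<oplus> t \<otimes> mon \<alpha>"
    using mon st assms(2) closed by (simp add: l_distr flip: m_assoc)
  then show ?case
    using mon st assms(3)[OF mon(2,3)] PQ by (simp add: span_on_add span_on_smult span_on_mon)
next
  case (add u v)
  then show ?case using assms(2) closed by (simp add: r_distr span_on_add)
qed (use assms(2) closed span_on_zero in simp)

lemma affine_mult_span:
  assumes "a \<in> left_span R S (insert \<one> (x ` {1..n}))" "v \<in> span_on P"
    and "\<And>i. i \<in> {1..n} \<Longrightarrow> x i \<otimes> v \<in> span_on P"
  shows "a \<otimes> v \<in> span_on P"
proof -
  have gens: "insert \<one> (x ` {1..n}) \<subseteq> carrier R" using gens_closed by auto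
  note v = span_on_closed[OF assms(2)]
  show ?thesis
    using assms(1)
  proof (induction rule: left_span.induct)
    case (add s m u)
    have m: "m \<in> carrier R" using add gens by auto
    have "m \<otimes> v \<in> span_on P" using add(2) assms(2,3) v by auto
    moreover have "(s \<otimes> m \<oplus> u) \<otimes> v = s \<otimes> (m \<otimes> v) \<oplus> u \<otimes> v"
      using add m v left_span_carrier[OF gens] subring_elem by (simp add: l_distr m_assoc)
    ultimately show ?case using add by (simp add: span_on_add span_on_smult)
  qed (simp add: v span_on_zero)
qed

lemma filt_mono: "d \<le> e \<Longrightarrow> v \<in> filt d \<Longrightarrow> v \<in> filt e"
  by (erule span_on_mono[rotated]) simp

text \<open>Straightening: $x_i x^\alpha \in S x^{\alpha + e_i}$ modulo degree at most $|\alpha|$.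
  Write $x^\alpha = x_j x^{\alpha'}$ with $j$ the first position in use. For $i \le j$ the product is
  standard already. Otherwise replace $x_i x_j$ by $c x_j x_i$ plus affine terms; the induction
  hypothesis straightens $x_i x^{\alpha'}$, and $x_j$ times the result is standard up to terms of lower
  degree. The hypothesis is needed for all generators and all exponents of degree at most
  $|\alpha'|$, because of these terms.\<close>

lemma gen_mult_mon:
  assumes "\<alpha> \<in> exponents n" "i \<in> {1..n}"
  shows "\<exists>s\<in>S. \<exists>v\<in>filt (Suc (total_degree n \<alpha>)). x i \<otimes> mon \<alpha> = s \<otimes> mon (raise \<alpha> i) \<oplus> v"
  using assms
proof (induction arbitrary: i rule: exponents_induct)
  case zero
  show ?case
    by (rule unit_multiple_form[OF mon_closed], rule gen_mult_mon_exact[OF zero]) (use zero in auto)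
next
  case (raise j \<alpha>)
  let ?d = "total_degree n \<alpha>"
  let ?\<alpha>j = "raise \<alpha> j"
  have deg: "total_degree n ?\<alpha>j = Suc ?d" by (rule total_degree_raise[OF raise(1)])
  have exact: "x j \<otimes> mon \<alpha> = mon ?\<alpha>j" by (rule gen_mult_mon_exact[OF raise(1,3)])
  show ?case
  proof (cases "i \<le> j")
    case True
    then have "x i \<otimes> mon ?\<alpha>j = mon (raise ?\<alpha>j i)"
      using raise by (intro gen_mult_mon_exact) (auto simp: raise_apply)
    then show ?thesis
      by (rule unit_multiple_form[OF mon_closed])
  next
    case False
    have step: "x k \<otimes> mon \<beta> \<in> filt (Suc (Suc (total_degree n \<beta>)))"
      if k: "k \<in> {1..n}" and \<beta>: "\<beta> \<in> exponents n" "total_degree n \<beta> \<le> ?d" for k \<beta>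
    proof -
      obtain s v where "s \<in> S" "v \<in> filt (Suc (total_degree n \<beta>))"
        "x k \<otimes> mon \<beta> = s \<otimes> mon (raise \<beta> k) \<oplus> v"
        using raise.IH[OF \<beta> k] by blast
      moreover have "mon (raise \<beta> k) \<in> filt (Suc (Suc (total_degree n \<beta>)))"
        by (rule span_on_mon) (use k \<beta> raise_exponents total_degree_raise in auto)
      ultimately show ?thesis
        using filt_mono[of "Suc (total_degree n \<beta>)" "Suc (Suc (total_degree n \<beta>))"]
        by (simp add: span_on_add span_on_smult)
    qed
    obtain s v where sv: "s \<in> S" "v \<in> filt (Suc ?d)" "x i \<otimes> mon \<alpha> = s \<otimes> mon (raise \<alpha> i) \<oplus> v"
      using raise.IH[OF raise(2) order_refl raise.prems] by blast
    obtain c a where ca: "c \<in> S" "a \<in> left_span R S (insert \<one> (x ` {1..n}))"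
      "x i \<otimes> x j = c \<otimes> (x j \<otimes> x i) \<oplus> a"
      using gen_past_gen[OF raise.prems raise(1)] by blast
    obtain s' t where st: "s' \<in> S" "t \<in> S" "x j \<otimes> s = s' \<otimes> x j \<oplus> t"
      using gen_past_coeff[OF raise(1) sv(1)] by blast
    have a: "a \<in> carrier R"
      by (rule left_span_carrier[OF _ ca(2)]) (use gens_closed in auto)
    have exact': "x j \<otimes> mon (raise \<alpha> i) = mon (raise ?\<alpha>j i)"
      unfolding raise_commute[of \<alpha> j i] using False raise by (intro gen_mult_mon_exact) (auto simp: raise_apply)
    have "x j \<otimes> v \<in> filt (Suc (Suc ?d))"
      using sv(2)
    proof (rule gen_mult_span[OF _ raise(1)])
      fix \<beta> assume "\<beta> \<in> exponents n" "total_degree n \<beta> < Suc ?d"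
      then show "x j \<otimes> mon \<beta> \<in> filt (Suc (Suc ?d))"
        using step[OF raise(1), of \<beta>] filt_mono[of "Suc (Suc (total_degree n \<beta>))" "Suc (Suc ?d)"]
        by simp
    qed simp
    moreover have "a \<otimes> mon \<alpha> \<in> filt (Suc (Suc ?d))"
      by (rule affine_mult_span[OF ca(2) span_on_mon[OF raise(2)] step[OF _ raise(2) order_refl]]) simp
    moreover have "mon (raise \<alpha> i) \<in> filt (Suc (Suc ?d))"
      by (rule span_on_mon) (use raise raise_exponents total_degree_raise in auto)
    moreover have "x i \<otimes> mon ?\<alpha>j = (c \<otimes> s') \<otimes> mon (raise ?\<alpha>j i) \<oplus>
      (c \<otimes> (t \<otimes> mon (raise \<alpha> i) \<oplus> x j \<otimes> v) \<oplus> a \<otimes> mon \<alpha>)"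
    proof -
      note cl = closed(1)[OF raise(1)] closed(1)[OF raise.prems] mon_closed closed(3)[OF sv(2)]
        subring_elem[OF ca(1)] subring_elem[OF st(1)] subring_elem[OF st(2)] subring_elem[OF sv(1)] a
      have "x i \<otimes> mon ?\<alpha>j = (x i \<otimes> x j) \<otimes> mon \<alpha>"
        unfolding exact[symmetric] using cl by (simp add: m_assoc)
      also have "\<dots> = c \<otimes> (x j \<otimes> (x i \<otimes> mon \<alpha>)) \<oplus> a \<otimes> mon \<alpha>"
        unfolding ca(3) using cl by (simp add: m_assoc l_distr)
      also have "x j \<otimes> (x i \<otimes> mon \<alpha>) = (x j \<otimes> s) \<otimes> mon (raise \<alpha> i) \<oplus> x j \<otimes> v"
        unfolding sv(3) using cl by (simp add: m_assoc r_distr)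
      also have "(x j \<otimes> s) \<otimes> mon (raise \<alpha> i) = s' \<otimes> mon (raise ?\<alpha>j i) \<oplus> t \<otimes> mon (raise \<alpha> i)"
        unfolding st(3) exact'[symmetric] using cl by (simp add: m_assoc l_distr)
      finally show ?thesis using cl by (simp add: r_distr m_assoc a_assoc)
    qed
    ultimately show ?thesis
      unfolding deg using ca(1) st(1,2) m_closed[of c s']
      by (metis span_on_add span_on_smult)
  qed
qed

lemma gen_mult_filt:
  assumes "i \<in> {1..n}" "v \<in> filt d"
  shows "x i \<otimes> v \<in> filt (Suc d)"
  using assms(2)
proof (rule gen_mult_span[OF _ assms(1)])
  fix \<alpha> assume \<alpha>: "\<alpha> \<in> exponents n" "total_degree n \<alpha> < d"
  obtain s v where "s \<in> S" "v \<in> filt (Suc (total_degree n \<alpha>))"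
    "x i \<otimes> mon \<alpha> = s \<otimes> mon (raise \<alpha> i) \<oplus> v"
    using gen_mult_mon[OF \<alpha>(1) assms(1)] by blast
  moreover have "mon (raise \<alpha> i) \<in> filt (Suc d)"
    by (rule span_on_mon) (use \<alpha> assms(1) raise_exponents total_degree_raise in auto)
  ultimately show "x i \<otimes> mon \<alpha> \<in> filt (Suc d)"
    using \<alpha>(2) filt_mono[of "Suc (total_degree n \<alpha>)" "Suc d"]
    by (simp add: span_on_add span_on_smult)
qed simp

text \<open>The converse of straightening: $x^{\alpha + e_i} \in S x_i x^\alpha$ modulo degree at most
  $|\alpha|$. This is where the rule for $x_j x_i$ with $j < i$ enters, which rewrites a standard
  product by a nonstandard one. It replaces the statement that the leading coefficient in
  \<open>gen_mult_mon\<close> is a unit.\<close>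

lemma mon_raise:
  assumes "\<alpha> \<in> exponents n" "i \<in> {1..n}"
  shows "\<exists>w\<in>S. \<exists>v\<in>filt (Suc (total_degree n \<alpha>)). mon (raise \<alpha> i) = w \<otimes> (x i \<otimes> mon \<alpha>) \<oplus> v"
  using assms
proof (induction arbitrary: i rule: exponents_induct)
  case zero
  show ?case
    by (rule unit_multiple_form[OF monoid.m_closed[OF monoid_axioms gens_closed[OF zero] mon_closed]], rule sym,
        rule gen_mult_mon_exact[OF zero]) (use zero in auto)
next
  case (raise j \<alpha>)
  let ?d = "total_degree n \<alpha>"
  let ?\<alpha>j = "raise \<alpha> j"
  have deg: "total_degree n ?\<alpha>j = Suc ?d" by (rule total_degree_raise[OF raise(1)])
  have exact: "x j \<otimes> mon \<alpha> = mon ?\<alpha>j" by (rule gen_mult_mon_exact[OF raise(1,3)])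
  show ?case
  proof (cases "i \<le> j")
    case True
    then have "x i \<otimes> mon ?\<alpha>j = mon (raise ?\<alpha>j i)"
      using raise by (intro gen_mult_mon_exact) (auto simp: raise_apply)
    then show ?thesis
      using closed(1)[OF raise.prems] by (intro unit_multiple_form monoid.m_closed[OF monoid_axioms] mon_closed) auto
  next
    case False
    obtain w v where wv: "w \<in> S" "v \<in> filt (Suc ?d)"
      "mon (raise \<alpha> i) = w \<otimes> (x i \<otimes> mon \<alpha>) \<oplus> v"
      using raise.IH[OF raise(2) order_refl raise.prems] by blast
    obtain c a where ca: "c \<in> S" "a \<in> left_span R S (insert \<one> (x ` {1..n}))"
      "x j \<otimes> x i = c \<otimes> (x i \<otimes> x j) \<oplus> a"
      using gen_past_gen[OF raise(1) raise.prems] by blast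
    obtain w' t where wt: "w' \<in> S" "t \<in> S" "x j \<otimes> w = w' \<otimes> x j \<oplus> t"
      using gen_past_coeff[OF raise(1) wv(1)] by blast
    have a: "a \<in> carrier R"
      by (rule left_span_carrier[OF _ ca(2)]) (use gens_closed in auto)
    have exact': "x j \<otimes> mon (raise \<alpha> i) = mon (raise ?\<alpha>j i)"
      unfolding raise_commute[of \<alpha> j i] using False raise by (intro gen_mult_mon_exact) (auto simp: raise_apply)
    have mon: "mon \<alpha> \<in> filt (Suc ?d)" by (rule span_on_mon[OF raise(2)]) simp
    have step: "x k \<otimes> mon \<alpha> \<in> filt (Suc (Suc ?d))" if "k \<in> {1..n}" for k
      by (rule gen_mult_filt[OF that mon])
    have "a \<otimes> mon \<alpha> \<in> filt (Suc (Suc ?d))"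
      by (rule affine_mult_span[OF ca(2) span_on_mon[OF raise(2)] step]) simp
    moreover note step[OF raise.prems] gen_mult_filt[OF raise(1) wv(2)]
    moreover have "mon (raise ?\<alpha>j i) = (w' \<otimes> c) \<otimes> (x i \<otimes> mon ?\<alpha>j) \<oplus>
      (w' \<otimes> (a \<otimes> mon \<alpha>) \<oplus> t \<otimes> (x i \<otimes> mon \<alpha>) \<oplus> x j \<otimes> v)"
    proof -
      note cl = closed(1)[OF raise(1)] closed(1)[OF raise.prems] mon_closed closed(3)[OF wv(2)]
        subring_elem[OF ca(1)] subring_elem[OF wt(1)] subring_elem[OF wt(2)] subring_elem[OF wv(1)] a
      have "mon (raise ?\<alpha>j i) = (x j \<otimes> w) \<otimes> (x i \<otimes> mon \<alpha>) \<oplus> x j \<otimes> v"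
        unfolding exact'[symmetric] wv(3) using cl by (simp add: m_assoc r_distr)
      also have "\<dots> = w' \<otimes> ((x j \<otimes> x i) \<otimes> mon \<alpha>) \<oplus> t \<otimes> (x i \<otimes> mon \<alpha>) \<oplus> x j \<otimes> v"
        unfolding wt(3) using cl by (simp add: m_assoc l_distr)
      also have "(x j \<otimes> x i) \<otimes> mon \<alpha> = c \<otimes> (x i \<otimes> mon ?\<alpha>j) \<oplus> a \<otimes> mon \<alpha>"
        unfolding ca(3) exact[symmetric] using cl by (simp add: m_assoc l_distr)
      finally show ?thesis using cl by (simp add: r_distr m_assoc a_assoc)
    qed
    ultimately show ?thesis
      unfolding deg using ca(1) wt(1,2) m_closed[of w' c]
      by (metis span_on_add span_on_smult)
  qed
qed

text \<open>A coefficient moves from the right of a monomial to its left, generator by generator.\<close>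

lemma mon_past_coeff:
  assumes "\<alpha> \<in> exponents n" "s \<in> S"
  shows "\<exists>s'\<in>S. \<exists>v\<in>filt (total_degree n \<alpha>). mon \<alpha> \<otimes> s = s' \<otimes> mon \<alpha> \<oplus> v"
  using assms
proof (induction arbitrary: s rule: exponents_induct)
  case zero
  show ?case
    unfolding mon_zero
    by (rule bexI[OF _ zero], rule bexI[OF _ span_on_zero]) (use subring_elem[OF zero] in simp)
next
  case (raise j \<alpha>)
  let ?d = "total_degree n \<alpha>"
  have deg: "total_degree n (raise \<alpha> j) = Suc ?d" by (rule total_degree_raise[OF raise(1)])
  have exact: "x j \<otimes> mon \<alpha> = mon (raise \<alpha> j)" by (rule gen_mult_mon_exact[OF raise(1,3)])
  obtain s' v where sv: "s' \<in> S" "v \<in> filt ?d" "mon \<alpha> \<otimes> s = s' \<otimes> mon \<alpha> \<oplus> v"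
    using raise.IH[OF raise(2) order_refl raise.prems] by blast
  obtain s'' t where st: "s'' \<in> S" "t \<in> S" "x j \<otimes> s' = s'' \<otimes> x j \<oplus> t"
    using gen_past_coeff[OF raise(1) sv(1)] by blast
  note cl = closed(1)[OF raise(1)] mon_closed closed(3)[OF sv(2)]
    subring_elem[OF sv(1)] subring_elem[OF st(1)] subring_elem[OF st(2)] subring_elem[OF raise.prems]
  have "mon (raise \<alpha> j) \<otimes> s = (x j \<otimes> s') \<otimes> mon \<alpha> \<oplus> x j \<otimes> v"
    unfolding exact[symmetric] using cl sv(3) by (simp add: m_assoc r_distr)
  also have "\<dots> = s'' \<otimes> mon (raise \<alpha> j) \<oplus> (t \<otimes> mon \<alpha> \<oplus> x j \<otimes> v)"
    unfolding exact[symmetric] st(3) using cl by (simp add: m_assoc l_distr a_assoc)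
  finally have "mon (raise \<alpha> j) \<otimes> s = s'' \<otimes> mon (raise \<alpha> j) \<oplus> (t \<otimes> mon \<alpha> \<oplus> x j \<otimes> v)" .
  moreover have "t \<otimes> mon \<alpha> \<oplus> x j \<otimes> v \<in> filt (Suc ?d)"
    by (intro span_on_add span_on_smult span_on_mon st gen_mult_filt raise sv) simp
  ultimately show ?case unfolding deg using st(1) by blast
qed

text \<open>A coefficient moves from the left of a monomial to its right; this is the rule that gives
  leading forms with coefficients on the right.\<close>

lemma coeff_past_mon:
  assumes "\<alpha> \<in> exponents n" "s \<in> S"
  shows "\<exists>s'\<in>S. \<exists>v\<in>filt (total_degree n \<alpha>). s \<otimes> mon \<alpha> = mon \<alpha> \<otimes> s' \<oplus> v"
  using assms
proof (induction arbitrary: s rule: exponents_induct)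
  case zero
  show ?case
    unfolding mon_zero
    by (rule bexI[OF _ zero], rule bexI[OF _ span_on_zero]) (use subring_elem[OF zero] in simp)
next
  case (raise j \<alpha>)
  let ?d = "total_degree n \<alpha>"
  have deg: "total_degree n (raise \<alpha> j) = Suc ?d" by (rule total_degree_raise[OF raise(1)])
  have exact: "x j \<otimes> mon \<alpha> = mon (raise \<alpha> j)" by (rule gen_mult_mon_exact[OF raise(1,3)])
  obtain s' t where st: "s' \<in> S" "t \<in> S" "s \<otimes> x j = x j \<otimes> s' \<oplus> t"
    using coeff_past_gen[OF raise(1) raise.prems] by blast
  obtain s'' v where sv: "s'' \<in> S" "v \<in> filt ?d" "s' \<otimes> mon \<alpha> = mon \<alpha> \<otimes> s'' \<oplus> v"
    using raise.IH[OF raise(2) order_refl st(1)] by blast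
  note cl = closed(1)[OF raise(1)] mon_closed closed(3)[OF sv(2)]
    subring_elem[OF sv(1)] subring_elem[OF st(1)] subring_elem[OF st(2)] subring_elem[OF raise.prems]
  have "s \<otimes> mon (raise \<alpha> j) = (s \<otimes> x j) \<otimes> mon \<alpha>"
    unfolding exact[symmetric] using cl by (simp add: m_assoc)
  also have "\<dots> = x j \<otimes> (s' \<otimes> mon \<alpha>) \<oplus> t \<otimes> mon \<alpha>"
    unfolding st(3) using cl by (simp add: m_assoc l_distr)
  also have "\<dots> = mon (raise \<alpha> j) \<otimes> s'' \<oplus> (x j \<otimes> v \<oplus> t \<otimes> mon \<alpha>)"
    unfolding exact[symmetric] sv(3) using cl by (simp add: m_assoc r_distr a_assoc)
  finally have "s \<otimes> mon (raise \<alpha> j) = mon (raise \<alpha> j) \<otimes> s'' \<oplus> (x j \<otimes> v \<oplus> t \<otimes> mon \<alpha>)" .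
  moreover have "x j \<otimes> v \<oplus> t \<otimes> mon \<alpha> \<in> filt (Suc ?d)"
    by (intro span_on_add span_on_smult span_on_mon st gen_mult_filt raise sv) simp
  ultimately show ?case unfolding deg using sv(1) by blast
qed

lemma filt_lower:
  assumes "d \<le> total_degree n \<alpha>" "v \<in> filt d"
  shows "v \<in> lower \<alpha>"
  using assms(2) by (rule span_on_mono[rotated]) (use assms(1) in \<open>auto simp: deglex_def\<close>)

lemma lower_mult_coeff:
  assumes "v \<in> lower \<alpha>" "s \<in> S"
  shows "v \<otimes> s \<in> lower \<alpha>"
  using assms(1)
proof (induction rule: span_on_induct)
  case (mon t \<beta>)
  obtain s' u where su: "s' \<in> S" "u \<in> filt (total_degree n \<beta>)" "mon \<beta> \<otimes> s = s' \<otimes> mon \<beta> \<oplus> u"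
    using mon_past_coeff[OF mon(2) assms(2)] by blast
  have "total_degree n \<beta> \<le> total_degree n \<alpha>" using mon(3) by (auto simp: deglex_def)
  then have "s' \<otimes> mon \<beta> \<oplus> u \<in> lower \<alpha>"
    using su mon filt_lower by (intro span_on_add span_on_smult span_on_mon) auto
  then show ?case
    using mon closed assms(2) by (simp add: m_assoc su(3) span_on_smult)
next
  case (add u v)
  then show ?case using closed assms(2) by (simp add: l_distr span_on_add)
qed (use closed assms(2) span_on_zero in simp)

lemma gen_mult_lower:
  assumes "i \<in> {1..n}" "v \<in> lower \<alpha>"
  shows "x i \<otimes> v \<in> lower (raise \<alpha> i)"
  using assms(2)
proof (rule gen_mult_span[OF _ assms(1)])
  fix \<beta> assume \<beta>: "\<beta> \<in> exponents n" "deglex n \<beta> \<alpha>"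
  then have deg: "total_degree n \<beta> < total_degree n (raise \<alpha> i)"
    using total_degree_raise[OF assms(1)] by (auto simp: deglex_def)
  then show "deglex n \<beta> (raise \<alpha> i)" by (simp add: deglex_def)
  obtain s v where sv: "s \<in> S" "v \<in> filt (Suc (total_degree n \<beta>))"
    "x i \<otimes> mon \<beta> = s \<otimes> mon (raise \<beta> i) \<oplus> v"
    using gen_mult_mon[OF \<beta>(1) assms(1)] by blast
  have "v \<in> lower (raise \<alpha> i)" using sv(2) deg by (intro filt_lower) auto
  moreover have "mon (raise \<beta> i) \<in> lower (raise \<alpha> i)"
    by (intro span_on_mon raise_exponents deglex_raise \<beta> assms(1))
  ultimately show "x i \<otimes> mon \<beta> \<in> lower (raise \<alpha> i)"
    using sv by (simp add: span_on_add span_on_smult)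
qed

section \<open>Leading coefficients\<close>

text \<open>Leading coefficients stand to the right of the monomial: only then does \<open>lead J \<alpha>\<close> grow with
  \<open>\<alpha>\<close> as it stands, rather than up to an automorphism depending on \<open>\<alpha>\<close>.\<close>

definition lead :: "'a set \<Rightarrow> (nat \<Rightarrow> nat) \<Rightarrow> 'a set"
  where "lead J \<alpha> = {r \<in> S. \<exists>v\<in>lower \<alpha>. mon \<alpha> \<otimes> r \<oplus> v \<in> J}"

text \<open>For closure under multiplication by $s$, choose $s'$ with $x^\alpha s = s' x^\alpha$ up to
  lower terms. Then multiplying an element of \<open>J\<close> by $s'$ on the left multiplies its leading
  coefficient by $s$.\<close>

lemma left_ideal_lead:
  assumes J: "left_ideal J R" and \<alpha>: "\<alpha> \<in> exponents n"
  shows "left_ideal (lead J \<alpha>) (R\<lparr>carrier := S\<rparr>)"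
proof -
  interpret S: ring "R\<lparr>carrier := S\<rparr>" by (rule subring_is_ring[OF subring_axioms])
  show ?thesis
  proof (rule S.left_idealI, simp_all)
    show "lead J \<alpha> \<subseteq> S" by (auto simp: lead_def)
    show "\<zero> \<in> lead J \<alpha>"
      using left_idealD(2)[OF J] span_on_zero closed S.zero_closed by (auto simp: lead_def intro!: bexI[of _ \<zero>])
  next
    fix r r' assume "r \<in> lead J \<alpha>" "r' \<in> lead J \<alpha>"
    then obtain v v' where v: "r \<in> S" "v \<in> lower \<alpha>" "mon \<alpha> \<otimes> r \<oplus> v \<in> J"
      and v': "r' \<in> S" "v' \<in> lower \<alpha>" "mon \<alpha> \<otimes> r' \<oplus> v' \<in> J" by (auto simp: lead_def)
    note cl = mon_closed[of \<alpha>] subring_elem[OF v(1)] subring_elem[OF v'(1)]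
      span_on_closed[OF v(2)] span_on_closed[OF v'(2)]
    have "(mon \<alpha> \<otimes> r \<oplus> v) \<oplus> (mon \<alpha> \<otimes> r' \<oplus> v') = mon \<alpha> \<otimes> (r \<oplus> r') \<oplus> (v \<oplus> v')"
      using cl by (simp add: r_distr a_ac)
    then have "mon \<alpha> \<otimes> (r \<oplus> r') \<oplus> (v \<oplus> v') \<in> J"
      using left_idealD(3)[OF J v(3) v'(3)] by simp
    then show "r \<oplus> r' \<in> lead J \<alpha>"
      using S.a_closed[of r r'] v(1) v'(1) span_on_add[OF v(2) v'(2)] by (auto simp: lead_def)
  next
    fix s r assume s: "s \<in> S" and "r \<in> lead J \<alpha>"
    then obtain v where v: "r \<in> S" "v \<in> lower \<alpha>" "mon \<alpha> \<otimes> r \<oplus> v \<in> J" by (auto simp: lead_def)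
    obtain s' w where sw: "s' \<in> S" "w \<in> filt (total_degree n \<alpha>)"
      "mon \<alpha> \<otimes> s = s' \<otimes> mon \<alpha> \<oplus> w"
      using mon_past_coeff[OF \<alpha> s] by blast
    note cl = mon_closed[of \<alpha>] subring_elem[OF v(1)] subring_elem[OF s] subring_elem[OF sw(1)]
      span_on_closed[OF v(2)] span_on_closed[OF sw(2)]
    have "mon \<alpha> \<otimes> (s \<otimes> r) = (mon \<alpha> \<otimes> s) \<otimes> r" using cl by (simp add: m_assoc)
    also have "\<dots> = s' \<otimes> (mon \<alpha> \<otimes> r) \<oplus> w \<otimes> r" unfolding sw(3) using cl by (simp add: l_distr m_assoc)
    finally have "s' \<otimes> (mon \<alpha> \<otimes> r \<oplus> v) = mon \<alpha> \<otimes> (s \<otimes> r) \<oplus> (s' \<otimes> v \<ominus> w \<otimes> r)"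
      using cl by (simp only:) algebra
    then have "mon \<alpha> \<otimes> (s \<otimes> r) \<oplus> (s' \<otimes> v \<ominus> w \<otimes> r) \<in> J"
      using left_idealD(5)[OF J subring_elem[OF sw(1)] v(3)] by simp
    moreover have "s' \<otimes> v \<ominus> w \<otimes> r \<in> lower \<alpha>"
      by (intro span_on_minus span_on_smult sw v lower_mult_coeff filt_lower[OF order_refl])
    ultimately show "s \<otimes> r \<in> lead J \<alpha>"
      using S.m_closed[of s r] s v(1) by (auto simp: lead_def)
  qed
qed

text \<open>Multiply by $w x_i$, where $w$ is the coefficient from \<open>mon_raise\<close>.\<close>

lemma lead_raise:
  assumes J: "left_ideal J R" and \<alpha>: "\<alpha> \<in> exponents n" and i: "i \<in> {1..n}"
  shows "lead J \<alpha> \<subseteq> lead J (raise \<alpha> i)"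
proof
  fix r assume "r \<in> lead J \<alpha>"
  then obtain v where v: "r \<in> S" "v \<in> lower \<alpha>" "mon \<alpha> \<otimes> r \<oplus> v \<in> J" by (auto simp: lead_def)
  obtain w u where wu: "w \<in> S" "u \<in> filt (Suc (total_degree n \<alpha>))"
    "mon (raise \<alpha> i) = w \<otimes> (x i \<otimes> mon \<alpha>) \<oplus> u"
    using mon_raise[OF \<alpha> i] by blast
  note cl = mon_closed[of \<alpha>] gens_closed[OF i] subring_elem[OF v(1)] subring_elem[OF wu(1)]
    span_on_closed[OF v(2)] span_on_closed[OF wu(2)]
  have "mon (raise \<alpha> i) \<otimes> r = (w \<otimes> x i) \<otimes> (mon \<alpha> \<otimes> r) \<oplus> u \<otimes> r"
    unfolding wu(3) using cl by (simp add: l_distr m_assoc)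
  then have "(w \<otimes> x i) \<otimes> (mon \<alpha> \<otimes> r \<oplus> v) =
      mon (raise \<alpha> i) \<otimes> r \<oplus> (w \<otimes> (x i \<otimes> v) \<ominus> u \<otimes> r)"
    using cl by (simp only:) algebra
  moreover have "(w \<otimes> x i) \<otimes> (mon \<alpha> \<otimes> r \<oplus> v) \<in> J"
    using left_idealD(5)[OF J _ v(3)] cl by simp
  moreover have "w \<otimes> (x i \<otimes> v) \<ominus> u \<otimes> r \<in> lower (raise \<alpha> i)"
    by (intro span_on_minus span_on_smult wu v lower_mult_coeff gen_mult_lower i filt_lower[OF _ wu(2)])
      (simp add: total_degree_raise[OF i])
  ultimately show "r \<in> lead J (raise \<alpha> i)" using v(1) by (auto simp: lead_def)
qed

lemma lead_mono:
  assumes J: "left_ideal J R" and "\<alpha> \<in> exponents n" "\<beta> \<in> exponents n"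
    and "\<And>i. i \<in> {1..n} \<Longrightarrow> \<alpha> i \<le> \<beta> i"
  shows "lead J \<alpha> \<subseteq> lead J \<beta>"
  using assms(2,4)
proof (induction "total_degree n \<beta> - total_degree n \<alpha>" arbitrary: \<alpha> rule: less_induct)
  case less
  show ?case
  proof (cases "\<exists>i\<in>{1..n}. \<alpha> i < \<beta> i")
    case False
    then have "\<alpha> = \<beta>"
      using less.prems assms(3) unfolding exponents_def
      by (intro PiE_ext[of \<alpha> "{1..n}" "\<lambda>_. UNIV" \<beta>]) (auto simp: not_less intro: antisym)
    then show ?thesis by simp
  next
    case True
    then obtain i where i: "i \<in> {1..n}" "\<alpha> i < \<beta> i" by blast
    have le: "raise \<alpha> i k \<le> \<beta> k" if "k \<in> {1..n}" for k
      using less.prems(2)[OF that] i by (simp add: raise_apply)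
    then have "total_degree n (raise \<alpha> i) \<le> total_degree n \<beta>"
      unfolding total_degree_def by (intro sum_mono)
    then have "lead J (raise \<alpha> i) \<subseteq> lead J \<beta>"
      using less.hyps[OF _ raise_exponents[OF less.prems(1) i(1)] le] total_degree_raise[OF i(1), of \<alpha>]
      by simp
    then show ?thesis using lead_raise[OF J less.prems(1) i(1)] by blast
  qed
qed

abbreviation up_to :: "(nat \<Rightarrow> nat) \<Rightarrow> 'a set"
  where "up_to \<alpha> \<equiv> span_on (\<lambda>\<beta>. \<beta> = \<alpha> \<or> deglex n \<beta> \<alpha>)"

text \<open>A nonzero combination of monomials has a largest exponent; it need not be unique, as the
  monomials may be linearly dependent, but the exponent can be taken among those allowed by \<open>P\<close>.\<close>

lemma span_on_top:
  assumes "a \<in> span_on P"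
  shows "a = \<zero> \<or> (\<exists>\<alpha>\<in>exponents n. P \<alpha> \<and> a \<in> up_to \<alpha>)"
  using assms
proof (induction rule: span_on_induct)
  case (mon s \<alpha>)
  then show ?case by (intro disjI2 bexI[of _ \<alpha>]) (auto intro!: span_on_smult span_on_mon)
next
  case (add u v)
  note cl = span_on_closed[OF add(1)] span_on_closed[OF add(2)]
  show ?case
  proof (cases "u = \<zero> \<or> v = \<zero>")
    case True
    then show ?thesis using add cl by auto
  next
    case False
    then obtain \<alpha> \<beta> where \<alpha>: "\<alpha> \<in> exponents n" "P \<alpha>" "u \<in> up_to \<alpha>"
      and \<beta>: "\<beta> \<in> exponents n" "P \<beta>" "v \<in> up_to \<beta>" using add by blast
    have up_to: "w \<in> up_to \<delta>" if "w \<in> up_to \<gamma>" "deglex n \<gamma> \<delta>" for w \<gamma> \<delta>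
      using that(1) by (rule span_on_mono[rotated]) (use that(2) deglex_trans in blast)
    consider "\<alpha> = \<beta>" | "deglex n \<alpha> \<beta>" | "deglex n \<beta> \<alpha>" using deglex_total[OF \<alpha>(1) \<beta>(1)] by blast
    then show ?thesis
    proof cases
      case 1
      then show ?thesis using \<alpha> \<beta> span_on_add by blast
    next
      case 2
      then show ?thesis using \<beta> span_on_add[OF up_to[OF \<alpha>(3)] \<beta>(3)] by blast
    next
      case 3
      then show ?thesis using \<alpha> span_on_add[OF \<alpha>(3) up_to[OF \<beta>(3)]] by blast
    qed
  qed
qed simp

lemma leading_form:
  assumes \<alpha>: "\<alpha> \<in> exponents n" and "a \<in> up_to \<alpha>"
  shows "\<exists>r\<in>S. \<exists>v\<in>lower \<alpha>. a = mon \<alpha> \<otimes> r \<oplus> v"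
  using assms(2)
proof (induction rule: span_on_induct)
  case zero
  have "\<zero> \<in> S" using subring_is_ring[OF subring_axioms] ring.ring_simprules(2) by fastforce
  then show ?case
    using span_on_zero mon_closed by (intro bexI[of _ \<zero>]) auto
next
  case (mon s \<beta>)
  show ?case
  proof (cases "\<beta> = \<alpha>")
    case True
    then show ?thesis
      using coeff_past_mon[OF \<alpha> mon(1)] filt_lower[OF order_refl] by blast
  next
    case False
    have "\<zero> \<in> S" using subring_is_ring[OF subring_axioms] ring.ring_simprules(2) by fastforce
    moreover have "s \<otimes> mon \<beta> \<in> lower \<alpha>"
      using False mon by (intro span_on_smult span_on_mon) auto
    ultimately show ?thesis
      using mon_closed span_on_closed by (intro bexI[of _ \<zero>] bexI[of _ "s \<otimes> mon \<beta>"]) auto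
  qed
next
  case (add a b)
  then obtain r v r' v' where v: "r \<in> S" "v \<in> lower \<alpha>" "a = mon \<alpha> \<otimes> r \<oplus> v"
    and v': "r' \<in> S" "v' \<in> lower \<alpha>" "b = mon \<alpha> \<otimes> r' \<oplus> v'" by blast
  note cl = mon_closed[of \<alpha>] subring_elem[OF v(1)] subring_elem[OF v'(1)]
    span_on_closed[OF v(2)] span_on_closed[OF v'(2)]
  have "a \<oplus> b = mon \<alpha> \<otimes> (r \<oplus> r') \<oplus> (v \<oplus> v')"
    using cl by (simp add: v(3) v'(3) r_distr a_ac)
  moreover have "r \<oplus> r' \<in> S"
    using v(1) v'(1) subringE(7)[OF subring_axioms] by blast
  ultimately show ?case using span_on_add[OF v(2) v'(2)] by blast
qed

section \<open>A Hilbert basis theorem\<close>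

text \<open>The proof takes a sequence of elements of a left ideal \<open>J\<close>, each of minimal leading exponent
  outside the left ideal generated by its predecessors, and shows that one member can be reduced by
  them.\<close>

theorem left_noetherian:
  assumes "left_noetherian_ring (R\<lparr>carrier := S\<rparr>)"
  shows "left_noetherian_ring R"
proof (rule ccontr)
  interpret S: left_noetherian_ring "R\<lparr>carrier := S\<rparr>" by fact
  assume "\<not> left_noetherian_ring R"
  then obtain J where J: "left_ideal J R"
    and not_fg: "\<And>F. \<lbrakk>F \<subseteq> carrier R; finite F\<rbrakk> \<Longrightarrow> J \<noteq> gen_left_ideal R F"
    using ring_axioms unfolding left_noetherian_ring_def left_noetherian_ring_axioms_def by blast
  \<comment> \<open>\<open>good F f \<alpha>\<close>: among the elements of \<open>J\<close> outside the left ideal generated by \<open>F\<close>, \<open>f\<close> has the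
    smallest possible leading exponent, namely \<open>\<alpha>\<close>.\<close>
  define good where "good F f \<alpha> \<longleftrightarrow> f \<in> J - gen_left_ideal R F \<and> \<alpha> \<in> exponents n \<and> f \<in> up_to \<alpha> \<and>
      (\<forall>g\<in>J - gen_left_ideal R F. \<forall>\<beta>\<in>exponents n. g \<in> up_to \<beta> \<longrightarrow> \<not> deglex n \<beta> \<alpha>)" for F f \<alpha>
  have ex_good: "\<exists>f \<alpha>. good F f \<alpha>" if F: "finite F" "F \<subseteq> J" for F
  proof -
    have "F \<subseteq> carrier R" using F(2) left_idealD(1)[OF J] by blast
    note genF = left_ideal_gen_left_ideal[OF this]
    obtain f where f: "f \<in> J - gen_left_ideal R F"
      using not_fg[OF \<open>F \<subseteq> carrier R\<close> F(1)] gen_left_ideal_least[OF J F(2)] by blast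
    then have "f \<noteq> \<zero>" using left_idealD(2)[OF genF] by auto
    moreover have "f \<in> span_on (\<lambda>_. True)"
      using f left_idealD(1)[OF J] carrier_span_on by blast
    ultimately obtain \<alpha> where "\<alpha> \<in> exponents n" "f \<in> up_to \<alpha>"
      using span_on_top by blast
    then have \<alpha>: "\<alpha> \<in> {\<alpha> \<in> exponents n. \<exists>f\<in>J - gen_left_ideal R F. f \<in> up_to \<alpha>}" (is "_ \<in> ?E")
      using f by blast
    then obtain \<mu> where \<mu>: "\<mu> \<in> ?E" "\<And>\<beta>. deglex n \<beta> \<mu> \<Longrightarrow> \<beta> \<notin> ?E"
      using wf_deglex[of n, unfolded wf_eq_minimal] by (metis (mono_tags, lifting) case_prodI mem_Collect_eq)
    then obtain g where "g \<in> J - gen_left_ideal R F" "g \<in> up_to \<mu>" by blast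
    then have "good F g \<mu>" using \<mu> unfolding good_def by blast
    then show ?thesis by blast
  qed
  have "\<exists>h. \<forall>k::nat. good (fst ` h ` {..<k}) (fst (h k)) (snd (h k))"
  proof (rule dependent_wellorder_choice)
    fix r :: "'a \<times> (nat \<Rightarrow> nat)" and f g :: "nat \<Rightarrow> 'a \<times> (nat \<Rightarrow> nat)" and k :: nat
    assume "\<And>y. y < k \<Longrightarrow> f y = g y"
    then have "f ` {..<k} = g ` {..<k}" by auto
    then show "good (fst ` f ` {..<k}) (fst r) (snd r) = good (fst ` g ` {..<k}) (fst r) (snd r)"
      by simp
  next
    fix k :: nat and h :: "nat \<Rightarrow> 'a \<times> (nat \<Rightarrow> nat)"
    assume "\<And>y. y < k \<Longrightarrow> good (fst ` h ` {..<y}) (fst (h y)) (snd (h y))"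
    then have "fst ` h ` {..<k} \<subseteq> J" unfolding good_def by auto
    then show "\<exists>r. good (fst ` h ` {..<k}) (fst r) (snd r)"
      using ex_good[of "fst ` h ` {..<k}"] by auto
  qed
  then obtain h where h: "\<And>k::nat. good (fst ` h ` {..<k}) (fst (h k)) (snd (h k))" by blast
  define f where "f k = fst (h k)" for k
  define \<alpha> where "\<alpha> k = snd (h k)" for k
  have good: "good (f ` {..<k}) (f k) (\<alpha> k)" for k
    using h[of k] unfolding f_def \<alpha>_def image_image .
  then have f: "f k \<in> J" "f k \<notin> gen_left_ideal R (f ` {..<k})" "\<alpha> k \<in> exponents n"
    and "f k \<in> up_to (\<alpha> k)"
    and minimal: "\<And>g \<beta>. \<lbrakk>g \<in> J; g \<notin> gen_left_ideal R (f ` {..<k}); \<beta> \<in> exponents n; g \<in> up_to \<beta>\<rbrakk>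
      \<Longrightarrow> \<not> deglex n \<beta> (\<alpha> k)" for k
    unfolding good_def by blast+
  then have "\<forall>k. \<exists>r v. r \<in> S \<and> v \<in> lower (\<alpha> k) \<and> f k = mon (\<alpha> k) \<otimes> r \<oplus> v"
    using leading_form by blast
  then obtain r v where rv: "\<And>k. r k \<in> S" "\<And>k. v k \<in> lower (\<alpha> k)"
    "\<And>k. f k = mon (\<alpha> k) \<otimes> r k \<oplus> v k" by metis
  \<comment> \<open>The leading coefficients are compared along a subsequence with increasing exponents, where
    \<open>lead_mono\<close> moves the earlier ones to the exponent of the last.\<close>
  obtain \<phi> :: "nat \<Rightarrow> nat" where \<phi>: "strict_mono \<phi>" "\<And>i. i \<in> {1..n} \<Longrightarrow> mono (\<lambda>k. \<alpha> (\<phi> k) i)"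
    using dickson_monotone_subsequence[of "{1..n}" \<alpha>] by blast
  obtain m where m: "r (\<phi> m) \<in> gen_left_ideal (R\<lparr>carrier := S\<rparr>) ((r \<circ> \<phi>) ` {..<m})"
    using S.sequence_redundant[of "r \<circ> \<phi>"] rv(1) by auto
  let ?J = "gen_left_ideal R (f ` {..<\<phi> m})"
  have fJ: "f ` {..<\<phi> m} \<subseteq> J" using f(1) by blast
  have J': "left_ideal ?J R"
    by (rule left_ideal_gen_left_ideal) (use fJ left_idealD(1)[OF J] in blast)
  have "(r \<circ> \<phi>) ` {..<m} \<subseteq> lead ?J (\<alpha> (\<phi> m))"
  proof clarify
    fix k assume k: "k < m"
    then have "f (\<phi> k) \<in> ?J"
      using gen_left_ideal_incl[of "f ` {..<\<phi> m}" R] strict_monoD[OF \<phi>(1) k] by blast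
    then have "r (\<phi> k) \<in> lead ?J (\<alpha> (\<phi> k))"
      using rv unfolding lead_def by auto
    moreover have "lead ?J (\<alpha> (\<phi> k)) \<subseteq> lead ?J (\<alpha> (\<phi> m))"
    proof (rule lead_mono[OF J' f(3) f(3)])
      show "\<alpha> (\<phi> k) i \<le> \<alpha> (\<phi> m) i" if "i \<in> {1..n}" for i
        using monoD[OF \<phi>(2)[OF that], of k m] k by simp
    qed
    ultimately show "(r \<circ> \<phi>) k \<in> lead ?J (\<alpha> (\<phi> m))" by auto
  qed
  then have "r (\<phi> m) \<in> lead ?J (\<alpha> (\<phi> m))"
    using gen_left_ideal_least[OF left_ideal_lead[OF J' f(3)]] m by blast
  then obtain u where u: "u \<in> lower (\<alpha> (\<phi> m))" "mon (\<alpha> (\<phi> m)) \<otimes> r (\<phi> m) \<oplus> u \<in> ?J" (is "?b \<in> ?J")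
    by (auto simp: lead_def)
  \<comment> \<open>\<open>?b\<close> has the same leading form as \<open>f (\<phi> m)\<close>, so the difference has a smaller exponent.\<close>
  let ?g = "f (\<phi> m) \<ominus> ?b"
  note cl = mon_closed[of "\<alpha> (\<phi> m)"] subring_elem[OF rv(1)[of "\<phi> m"]]
    span_on_closed[OF u(1)] span_on_closed[OF rv(2)[of "\<phi> m"]]
  have "?g = v (\<phi> m) \<ominus> u"
    unfolding rv(3) using cl by algebra
  then have "?g \<in> lower (\<alpha> (\<phi> m))"
    using span_on_minus[OF rv(2) u(1)] by simp
  moreover have gJ: "?g \<in> J"
    using left_idealD(4)[OF J f(1)] u(2) gen_left_ideal_least[OF J fJ] by blast
  moreover have g: "?g \<notin> ?J"
  proof
    assume "?g \<in> ?J"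
    then have "?g \<oplus> ?b \<in> ?J" by (rule left_idealD(3)[OF J' _ u(2)])
    moreover have "?g \<oplus> ?b = f (\<phi> m)"
      using cl left_idealD(1)[OF J] f(1)[of "\<phi> m"] unfolding rv(3) by algebra
    ultimately show False using f(2) by simp
  qed
  then have "?g \<noteq> \<zero>" using left_idealD(2)[OF J'] by metis
  ultimately obtain \<beta> where "\<beta> \<in> exponents n" "deglex n \<beta> (\<alpha> (\<phi> m))" "?g \<in> up_to \<beta>"
    using span_on_top by blast
  then show False using minimal[OF gJ g] by blast
qed

end

section \<open>Ring homomorphisms and their images\<close>

lemma ring_hom_factors_through_quotient:
  assumes I: "ideal I P" and h: "ring_hom_ring P Q h" and kernel: "\<And>a. a \<in> I \<Longrightarrow> h a = \<zero>\<^bsub>Q\<^esub>"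
  shows "\<exists>g. ring_hom_ring (P Quot I) Q g \<and> (\<forall>a\<in>carrier P. g (I +>\<^bsub>P\<^esub> a) = h a)"
proof -
  interpret I: ideal I P by fact
  interpret h: ring_hom_ring P Q h by fact
  interpret Quot: ring "P Quot I" by (rule I.quotient_is_ring)
  define g where "g U = h (SOME b. b \<in> U)" for U
  have g: "g (I +>\<^bsub>P\<^esub> a) = h a" if a: "a \<in> carrier P" for a
  proof -
    have "(SOME b. b \<in> I +>\<^bsub>P\<^esub> a) \<in> I +>\<^bsub>P\<^esub> a"
      using I.a_rcos_self[OF a] by (rule someI)
    then obtain i where "i \<in> I" "(SOME b. b \<in> I +>\<^bsub>P\<^esub> a) = i \<oplus>\<^bsub>P\<^esub> a"
      by (auto simp: a_r_coset_def r_coset_def)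
    then show ?thesis using a kernel[of i] I.a_Hcarr by (simp add: g_def)
  qed
  have coset: "\<exists>a\<in>carrier P. U = I +>\<^bsub>P\<^esub> a" if "U \<in> carrier (P Quot I)" for U
    using that by (auto simp: FactRing_def A_RCOSETS_def')
  have "g \<in> ring_hom (P Quot I) Q"
  proof (rule ring_hom_memI)
    fix U assume "U \<in> carrier (P Quot I)"
    then obtain a where "a \<in> carrier P" "U = I +>\<^bsub>P\<^esub> a" using coset[of U] by auto
    then show "g U \<in> carrier Q" using g by simp
  next
    fix U V assume "U \<in> carrier (P Quot I)" "V \<in> carrier (P Quot I)"
    then obtain a b where ab: "a \<in> carrier P" "b \<in> carrier P"
      "U = I +>\<^bsub>P\<^esub> a" "V = I +>\<^bsub>P\<^esub> b" using coset[of U] coset[of V] by auto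
    show "g (U \<otimes>\<^bsub>(P Quot I)\<^esub> V) = g U \<otimes>\<^bsub>Q\<^esub> g V"
      using ab by (simp add: FactRing_def I.rcoset_mult_add g)
    show "g (U \<oplus>\<^bsub>(P Quot I)\<^esub> V) = g U \<oplus>\<^bsub>Q\<^esub> g V"
      using ab by (simp add: FactRing_def I.a_rcos_sum g)
  next
    show "g \<one>\<^bsub>(P Quot I)\<^esub> = \<one>\<^bsub>Q\<^esub>" by (simp add: FactRing_def g)
  qed
  then have "ring_hom_ring (P Quot I) Q g"
    by (rule ring_hom_ringI2[OF Quot.ring_axioms h.S.ring_axioms])
  then show ?thesis using g by blast
qed

lemma left_noetherian_ring_range:
  assumes "left_noetherian_ring P" and "ring_hom_ring P Q h"
  shows "left_noetherian_ring (Q\<lparr>carrier := h ` carrier P\<rparr>)"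
proof -
  interpret h: ring_hom_ring P Q h by fact
  have "ring (Q\<lparr>carrier := h ` carrier P\<rparr>)"
    by (rule h.S.subring_is_ring[OF h.img_is_subring[OF h.R.carrier_is_subring]])
  moreover have "h \<in> ring_hom P (Q\<lparr>carrier := h ` carrier P\<rparr>)"
    by (rule ring_hom_memI) auto
  ultimately show ?thesis
    by (intro left_noetherian_ring_image[OF assms(1)] ring_hom_ringI2[OF h.R.ring_axioms]) auto
qed

lemma ring_hom_left_span:
  assumes "ring_hom_ring P Q h" "subring S P" "M \<subseteq> carrier P" "h ` S \<subseteq> S'"
    and "v \<in> left_span P S M"
  shows "h v \<in> left_span Q S' (h ` M)"
proof -
  interpret h: ring_hom_ring P Q h by fact
  interpret ring_with_subring P S
    using assms(2) h.R.ring_axioms by (simp add: ring_with_subring_def)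
  show ?thesis
    using assms(5)
  proof (induction rule: left_span.induct)
    case (add s m v)
    have "h (s \<otimes>\<^bsub>P\<^esub> m \<oplus>\<^bsub>P\<^esub> v) = h s \<otimes>\<^bsub>Q\<^esub> h m \<oplus>\<^bsub>Q\<^esub> h v"
      using add left_span_carrier[OF assms(3)] subring_elem assms(3) by (simp add: subset_iff)
    moreover have "h s \<in> S'" "h m \<in> h ` M" using add assms(4) by auto
    ultimately show ?case using add.IH by (simp add: left_span.add)
  qed (simp add: left_span.zero)
qed

lemma ring_hom_std_monomial:
  assumes "ring_hom_ring P Q h" "\<And>i. i \<in> {1..n} \<Longrightarrow> x i \<in> carrier P"
  shows "h (std_monomial P n x \<alpha>) = std_monomial Q n (h \<circ> x) \<alpha>"
proof -
  interpret h: ring_hom_ring P Q h by fact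
  let ?f = "\<lambda>i y. x i [^]\<^bsub>P\<^esub> \<alpha> i \<otimes>\<^bsub>P\<^esub> y"
  have "foldr ?f ks \<one>\<^bsub>P\<^esub> \<in> carrier P \<and>
      h (foldr ?f ks \<one>\<^bsub>P\<^esub>) = foldr (\<lambda>i y. h (x i) [^]\<^bsub>Q\<^esub> \<alpha> i \<otimes>\<^bsub>Q\<^esub> y) ks \<one>\<^bsub>Q\<^esub>"
    if "set ks \<subseteq> {1..n}" for ks
    using that by (induction ks) (auto simp: assms(2) h.hom_nat_pow)
  from this[of "[1..<Suc n]"] show ?thesis 
    by (auto simp: std_monomial_def atLeastLessThanSuc_atLeastAtMost simp del: upt_Suc)
qed

section \<open>Extension of scalars by a tensor factor\<close>

locale algebra_tensor = C: ring_algebra K C + A: ring_algebra K A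
  for K :: "('k, 'l) ring_scheme" and C :: "('k, 'c, 'm) module_scheme"
    and A :: "('k, 'a, 'n) module_scheme"
begin

abbreviation Z :: "('c \<times> 'a \<Rightarrow>\<^sub>0 int) ring" where "Z \<equiv> int_monoid_ring (C \<times>\<times> A)"

abbreviation T :: "('c \<times> 'a \<Rightarrow>\<^sub>0 int) set ring" where "T \<equiv> tensor_algebra_ring K C A"

abbreviation coset :: "('c \<times> 'a \<Rightarrow>\<^sub>0 int) \<Rightarrow> ('c \<times> 'a \<Rightarrow>\<^sub>0 int) set"
  where "coset f \<equiv> tensor_kernel K C A +>\<^bsub>Z\<^esub> f"

abbreviation tens :: "'c \<Rightarrow> 'a \<Rightarrow> ('c \<times> 'a \<Rightarrow>\<^sub>0 int) set"
  where "tens c a \<equiv> pure_tensor K C A c a"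

sublocale kernel: ideal "tensor_kernel K C A" Z
  by (rule tensor_kernel_ideal[OF C.ring_algebra_axioms A.ring_algebra_axioms])

sublocale T: ring T
  by (rule tensor_algebra_ring_is_ring[OF C.ring_algebra_axioms A.ring_algebra_axioms])

lemma coset_hom: "ring_hom_ring Z T coset"
  unfolding tensor_algebra_ring_def by (rule kernel.rcos_ring_hom_ring)

sublocale coset: ring_hom_ring Z T coset
  by (rule coset_hom)

lemma carrier_T: "carrier T = coset ` carrier Z"
  by (auto simp: tensor_algebra_ring_def FactRing_def A_RCOSETS_def')

lemma coset_minus:
  assumes "f \<in> carrier Z" "g \<in> carrier Z"
  shows "coset (f - g) = coset f \<ominus>\<^bsub>T\<^esub> coset g"
proof -
  have fg: "f - g \<in> carrier Z" using assms by (auto dest!: subsetD[OF keys_diff])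
  have "coset (f - g) \<oplus>\<^bsub>T\<^esub> coset g = coset f"
    using coset.hom_add[OF fg assms(2)] by simp
  then have "coset f \<ominus>\<^bsub>T\<^esub> coset g = coset (f - g) \<oplus>\<^bsub>T\<^esub> coset g \<ominus>\<^bsub>T\<^esub> coset g" by simp
  also have "\<dots> = coset (f - g)"
    using coset.hom_closed[OF fg] coset.hom_closed[OF assms(2)] by algebra
  finally show ?thesis by simp
qed

lemma coset_kernel: "f \<in> tensor_kernel K C A \<Longrightarrow> coset f = \<zero>\<^bsub>T\<^esub>"
  by (simp add: kernel.a_rcos_const tensor_algebra_ring_def FactRing_def)

lemma coset_relator: "t \<in> tensor_relators K C A \<Longrightarrow> coset t = \<zero>\<^bsub>T\<^esub>"
  by (rule coset_kernel) (simp add: tensor_kernel_def generate.incl)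

lemma frag_of_carrier: "\<lbrakk>c \<in> carrier C; a \<in> carrier A\<rbrakk> \<Longrightarrow> frag_of (c, a) \<in> carrier Z"
  by simp

lemma tens_closed: "\<lbrakk>c \<in> carrier C; a \<in> carrier A\<rbrakk> \<Longrightarrow> tens c a \<in> carrier T"
  unfolding pure_tensor_def by (rule coset.hom_closed[OF frag_of_carrier])

text \<open>The defining relator of additivity in the second factor lies in the kernel of the quotient map.\<close>

lemma tens_add_right:
  assumes "c \<in> carrier C" "a \<in> carrier A" "b \<in> carrier A"
  shows "tens c (a \<oplus>\<^bsub>A\<^esub> b) = tens c a \<oplus>\<^bsub>T\<^esub> tens c b"
proof -
  let ?s = "frag_of (c, a \<oplus>\<^bsub>A\<^esub> b)" and ?a = "frag_of (c, a)" and ?b = "frag_of (c, b)"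
  have ab: "?a \<in> carrier Z" "?b \<in> carrier Z" using assms by auto
  have ab': "?a \<oplus>\<^bsub>Z\<^esub> ?b \<in> carrier Z" using assms by (auto dest!: subsetD[OF keys_add])
  have d: "?s - ?a - ?b \<in> carrier Z"
    using assms by (auto dest!: subsetD[OF keys_diff])
  have "?s = (?s - ?a - ?b) \<oplus>\<^bsub>Z\<^esub> (?a \<oplus>\<^bsub>Z\<^esub> ?b)" by simp
  then have "coset ?s = coset (?s - ?a - ?b) \<oplus>\<^bsub>T\<^esub> (coset ?a \<oplus>\<^bsub>T\<^esub> coset ?b)"
    using coset.hom_add[OF d ab'] coset.hom_add[OF ab] by argo
  also have "coset (?s - ?a - ?b) = \<zero>\<^bsub>T\<^esub>"
    by (rule coset_relator) (use assms in \<open>auto intro: tensor_relators.add_right\<close>)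
  finally show ?thesis
    using coset.hom_closed[OF ab(1)] coset.hom_closed[OF ab(2)] unfolding pure_tensor_def
    by simp
qed

lemma tens_mult:
  "\<lbrakk>c \<in> carrier C; c' \<in> carrier C; a \<in> carrier A; a' \<in> carrier A\<rbrakk> \<Longrightarrow>
    tens c a \<otimes>\<^bsub>T\<^esub> tens c' a' = tens (c \<otimes>\<^bsub>C\<^esub> c') (a \<otimes>\<^bsub>A\<^esub> a')"
  by (rule pure_tensor_mult[OF C.ring_algebra_axioms A.ring_algebra_axioms])

text \<open>Every element of the tensor product is obtained from pure tensors by subtraction.\<close>

lemma coset_induct [consumes 2, case_names zero tens minus]:
  assumes "Poly_Mapping.keys f \<subseteq> carrier C \<times> D" "D \<subseteq> carrier A"
    and zero: "P \<zero>\<^bsub>T\<^esub>"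
    and tens: "\<And>c a. \<lbrakk>c \<in> carrier C; a \<in> D\<rbrakk> \<Longrightarrow> P (tens c a)"
    and minus: "\<And>s t. \<lbrakk>s \<in> carrier T; t \<in> carrier T; P s; P t\<rbrakk> \<Longrightarrow> P (s \<ominus>\<^bsub>T\<^esub> t)"
  shows "P (coset f)"
proof -
  have "f \<in> carrier Z \<and> P (coset f)"
    using assms(1)
  proof (induction f rule: frag_induction)
    case zero
    then show ?case using assms(3) coset.hom_zero by simp
  next
    case (one p)
    then show ?case using tens[of "fst p" "snd p"] assms(2) by (auto simp: pure_tensor_def)
  next
    case (diff f g)
    then have fg: "f \<in> carrier Z" "g \<in> carrier Z" "P (coset f)" "P (coset g)" by auto
    then have "f - g \<in> carrier Z" by (auto dest!: subsetD[OF keys_diff])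
    moreover have "P (coset (f - g))"
      unfolding coset_minus[OF fg(1,2)] by (intro minus coset.hom_closed fg)
    ultimately show ?case by blast
  qed
  then show ?thesis by simp
qed

lemma tens_one_hom: "ring_hom_ring A T (tens \<one>\<^bsub>C\<^esub>)"
proof (rule ring_hom_ringI2[OF A.ring_axioms T.ring_axioms], rule ring_hom_memI)
  show "tens \<one>\<^bsub>C\<^esub> \<one>\<^bsub>A\<^esub> = \<one>\<^bsub>T\<^esub>"
    by (simp add: pure_tensor_def tensor_algebra_ring_def FactRing_def)
qed (simp_all add: tens_closed tens_mult tens_add_right)

end

text \<open>The tensor products with \<open>A\<close> and with its subalgebra on the carrier \<open>R\<close> are both quotients of
  monoid rings, and the monoid ring of the second is contained in that of the first.\<close>

locale subalgebra_tensor = algebra_tensor K C A + subring R A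
  for K :: "('k, 'l) ring_scheme" and C :: "('k, 'c, 'm) module_scheme"
    and A :: "('k, 'a, 'n) module_scheme" and R :: "'a set" +
  assumes subalgebra: "ring_algebra K (A\<lparr>carrier := R\<rparr>)"
begin

sublocale sub: algebra_tensor K C "A\<lparr>carrier := R\<rparr>"
  using subalgebra C.ring_algebra_axioms by (simp add: algebra_tensor_def)

lemma tensor_kernel_mono: "tensor_kernel K C (A\<lparr>carrier := R\<rparr>) \<subseteq> tensor_kernel K C A"
proof -
  have rel: "t \<in> tensor_relators K C A" if "t \<in> tensor_relators K C (A\<lparr>carrier := R\<rparr>)" for t
    using that by cases (use subset in \<open>auto intro: tensor_relators.intros\<close>)
  have "f \<in> tensor_kernel K C A"
    if "f \<in> generate (free_Abelian_group (carrier C \<times> R)) (tensor_relators K C (A\<lparr>carrier := R\<rparr>))" for f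
    using that
  proof (induction rule: generate.induct)
    case one
    then show ?case using additive_subgroup.zero_closed[OF kernel.additive_subgroup_axioms] by simp
  next
    case (incl t)
    then show ?case using rel by (simp add: tensor_kernel_def generate.incl)
  next
    case (inv t)
    have t: "Poly_Mapping.keys t \<subseteq> carrier C \<times> R"
      using tensor_relators_carrier[OF C.module_axioms sub.A.module_axioms inv] by simp
    then have "Poly_Mapping.keys t \<subseteq> carrier C \<times> carrier A" using subset by auto
    with t have "inv\<^bsub>free_Abelian_group (carrier C \<times> R)\<^esub> t =
        inv\<^bsub>free_Abelian_group (carrier C \<times> carrier A)\<^esub> t" by simp
    then show ?case using rel[OF inv] by (simp add: tensor_kernel_def generate.inv)
  next
    case (eng f g)
    then show ?case using additive_subgroup.a_closed[OF kernel.additive_subgroup_axioms, of f g] by simp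
  qed
  then show ?thesis by (auto simp: tensor_kernel_def)
qed

text \<open>The image of $C \otimes_K R$ in $C \otimes_K A$, which inherits left Noetherianity as a quotient
  of $C \otimes_K R$.\<close>

definition coeffs :: "('c \<times> 'a \<Rightarrow>\<^sub>0 int) set set"
  where "coeffs = coset ` {f. Poly_Mapping.keys f \<subseteq> carrier C \<times> R}"

lemma coset_sub_hom: "ring_hom_ring sub.Z T coset"
proof (rule ring_hom_ringI2[OF sub.kernel.ring_axioms T.ring_axioms], rule ring_hom_memI)
  have sub: "f \<in> carrier Z" if "f \<in> carrier sub.Z" for f
    using that subset by auto
  fix f g assume fg: "f \<in> carrier sub.Z" "g \<in> carrier sub.Z"
  then show "coset f \<in> carrier T" by (intro coset.hom_closed sub)
  show "coset (f \<oplus>\<^bsub>sub.Z\<^esub> g) = coset f \<oplus>\<^bsub>T\<^esub> coset g"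
    using coset.hom_add[OF sub sub, OF fg] by simp
  have "f \<otimes>\<^bsub>sub.Z\<^esub> g = f \<otimes>\<^bsub>Z\<^esub> g"
    by (simp add: int_monoid_ring_mult DirProd_def)
  then show "coset (f \<otimes>\<^bsub>sub.Z\<^esub> g) = coset f \<otimes>\<^bsub>T\<^esub> coset g"
    using coset.hom_mult[OF sub sub, OF fg] by simp
next
  show "coset \<one>\<^bsub>sub.Z\<^esub> = \<one>\<^bsub>T\<^esub>"
    using coset.hom_one by (simp add: DirProd_def)
qed

text \<open>Relators over \<open>R\<close> are relators over \<open>A\<close>, so the inclusion of monoid rings induces a map
  between the quotients.\<close>

lemma coeffs_range: "\<exists>g. ring_hom_ring sub.T T g \<and> coeffs = g ` carrier sub.T"
proof -
  have "\<exists>g. ring_hom_ring sub.T T g \<and> (\<forall>f\<in>carrier sub.Z. g (sub.coset f) = coset f)"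
    unfolding tensor_algebra_ring_def[of K C "A\<lparr>carrier := R\<rparr>"]
    by (rule ring_hom_factors_through_quotient[OF sub.kernel.ideal_axioms coset_sub_hom])
      (use coset_kernel tensor_kernel_mono in blast)
  then obtain g where g: "ring_hom_ring sub.T T g"
    "\<And>f. f \<in> carrier sub.Z \<Longrightarrow> g (sub.coset f) = coset f" by auto
  have "coeffs = g ` carrier sub.T"
    unfolding sub.carrier_T image_image coeffs_def using g(2) by (intro image_cong) auto
  then show ?thesis using g(1) by blast
qed

lemma subring_coeffs: "subring coeffs T"
proof -
  obtain g where g: "ring_hom_ring sub.T T g" "coeffs = g ` carrier sub.T"
    using coeffs_range by blast
  show ?thesis
    unfolding g(2) by (rule ring_hom_ring.img_is_subring[OF g(1) sub.T.carrier_is_subring])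
qed

lemma left_noetherian_coeffs:
  assumes "left_noetherian_ring sub.T"
  shows "left_noetherian_ring (T\<lparr>carrier := coeffs\<rparr>)"
proof -
  obtain g where "ring_hom_ring sub.T T g" "coeffs = g ` carrier sub.T"
    using coeffs_range by blast
  then show ?thesis using left_noetherian_ring_range[OF assms] by metis
qed

sublocale coeffs: ring_with_subring T coeffs
  using subring_coeffs T.ring_axioms by (simp add: ring_with_subring_def)

lemma tens_coeffs: "\<lbrakk>c \<in> carrier C; r \<in> R\<rbrakk> \<Longrightarrow> tens c r \<in> coeffs"
  unfolding coeffs_def pure_tensor_def by (intro imageI) auto

lemma coeffs_minus: "\<lbrakk>a \<in> coeffs; b \<in> coeffs\<rbrakk> \<Longrightarrow> a \<ominus>\<^bsub>T\<^esub> b \<in> coeffs"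
  using subringE(5,7)[OF subring_coeffs] by (simp add: a_minus_def)

lemma coeffs_induct [consumes 1, case_names zero tens minus]:
  assumes s: "s \<in> coeffs"
    and zero: "P \<zero>\<^bsub>T\<^esub>"
    and tens: "\<And>c r. \<lbrakk>c \<in> carrier C; r \<in> R\<rbrakk> \<Longrightarrow> P (tens c r)"
    and minus: "\<And>a b. \<lbrakk>a \<in> coeffs; b \<in> coeffs; P a; P b\<rbrakk> \<Longrightarrow> P (a \<ominus>\<^bsub>T\<^esub> b)"
  shows "P s"
proof -
  obtain f where f: "Poly_Mapping.keys f \<subseteq> carrier C \<times> R" "s = coset f"
    using s unfolding coeffs_def by blast
  have "coset f \<in> coeffs \<and> P (coset f)"
    using f(1) subset
  proof (induction rule: coset_induct)
    case zero
    show ?case using assms(2) subringE(2)[OF subring_coeffs] by blast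
  next
    case (tens c r)
    then show ?case using assms(3) tens_coeffs by blast
  next
    case (minus s t)
    then show ?case using assms(4) coeffs_minus by blast
  qed
  then show ?thesis using f(2) by simp
qed

text \<open>All conditions are stable under subtraction in the coefficient, so it suffices to consider pure
  tensors $c \otimes r$; there the generator $1 \otimes x_i$ acts on the second factor as $x_i$ does
  in \<open>A\<close>. The rule for two generators is transported by the homomorphism $a \mapsto 1 \otimes a$.\<close>

lemma tensor_extension:
  assumes "almost_normalizing_extension A R n x"
  shows "almost_normalizing_extension T coeffs n (tens \<one>\<^bsub>C\<^esub> \<circ> x)"
proof -
  interpret X: almost_normalizing_extension A R n x by fact
  interpret \<phi>: ring_hom_ring A T "tens \<one>\<^bsub>C\<^esub>" by (rule tens_one_hom)
  let ?x = "tens \<one>\<^bsub>C\<^esub> \<circ> x"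
  let ?M = "std_monomial T n ?x ` exponents n"
  have R: "r \<in> carrier A" if "r \<in> R" for r using that subset by auto
  have gens: "?x i \<in> carrier T" if "i \<in> {1..n}" for i
    using X.gens_closed[OF that] by simp
  have mon: "tens \<one>\<^bsub>C\<^esub> (std_monomial A n x \<alpha>) = std_monomial T n ?x \<alpha>" for \<alpha>
    by (rule ring_hom_std_monomial[OF tens_one_hom X.gens_closed])
  have M: "?M \<subseteq> carrier T"
    using \<phi>.hom_closed[OF X.mon_closed] by (auto simp flip: mon)
  have coeffs: "tens \<one>\<^bsub>C\<^esub> ` R \<subseteq> coeffs" using tens_coeffs by auto
  have zero_coeffs: "\<zero>\<^bsub>T\<^esub> \<in> coeffs" by (rule subringE(2)[OF subring_coeffs])
  have tens_span: "tens c a \<in> left_span T coeffs ?M" if c: "c \<in> carrier C" and a: "a \<in> carrier A" for c a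
  proof -
    have "a \<in> left_span A R (std_monomial A n x ` exponents n)" using a X.spanning by blast
    then show ?thesis
    proof (induction rule: left_span.induct)
      case zero
      have "tens c \<zero>\<^bsub>A\<^esub> \<oplus>\<^bsub>T\<^esub> tens c \<zero>\<^bsub>A\<^esub> = tens c \<zero>\<^bsub>A\<^esub>"
        using tens_add_right[OF c, of "\<zero>\<^bsub>A\<^esub>" "\<zero>\<^bsub>A\<^esub>"] by simp
      then have "tens c \<zero>\<^bsub>A\<^esub> = \<zero>\<^bsub>T\<^esub>"
        using tens_closed[OF c, of "\<zero>\<^bsub>A\<^esub>"] T.add.r_cancel_one by simp
      then show ?case by (simp add: left_span.zero)
    next
      case (add s m v)
      obtain \<alpha> where \<alpha>: "\<alpha> \<in> exponents n" "m = std_monomial A n x \<alpha>" using add by auto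
      have v: "v \<in> carrier A" by (rule X.left_span_carrier[OF X.mon_set_closed add(3)])
      have "tens c (s \<otimes>\<^bsub>A\<^esub> m \<oplus>\<^bsub>A\<^esub> v) = tens c s \<otimes>\<^bsub>T\<^esub> tens \<one>\<^bsub>C\<^esub> m \<oplus>\<^bsub>T\<^esub> tens c v"
        using c add(1) v R X.mon_closed[of \<alpha>] by (simp add: tens_add_right tens_mult \<alpha>(2))
      moreover have "tens \<one>\<^bsub>C\<^esub> m \<in> ?M" using \<alpha> mon by auto
      ultimately show ?case
        using left_span.add[OF tens_coeffs[OF c add(1)] _ add.IH] by metis
    qed
  qed
  show ?thesis
  proof (intro almost_normalizing_extension.intro almost_normalizing_extension_axioms.intro
      coeffs.ring_with_subring_axioms)
    show "?x i \<in> carrier T" if "i \<in> {1..n}" for i by (rule gens[OF that])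
  next
    show "carrier T \<subseteq> left_span T coeffs ?M"
    proof
      fix t assume "t \<in> carrier T"
      then obtain f where f: "Poly_Mapping.keys f \<subseteq> carrier C \<times> carrier A" "t = coset f"
        unfolding carrier_T by auto
      have "coset f \<in> left_span T coeffs ?M"
        using f(1) order_refl
      proof (induction rule: coset_induct)
        case zero
        show ?case by (rule left_span.zero)
      next
        case (tens c a)
        then show ?case by (rule tens_span)
      next
        case (minus s t)
        show ?case by (rule coeffs.left_span_minus[OF M minus(3,4)])
      qed
      then show "t \<in> left_span T coeffs ?M" using f(2) by simp
    qed
  next
    fix i s assume i: "i \<in> {1..n}" and s: "s \<in> coeffs"
    note xi = gens[OF i] X.gens_closed[OF i]
    show "\<exists>s'\<in>coeffs. \<exists>t\<in>coeffs. ?x i \<otimes>\<^bsub>T\<^esub> s = s' \<otimes>\<^bsub>T\<^esub> ?x i \<oplus>\<^bsub>T\<^esub> t"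
      using s
    proof (induction rule: coeffs_induct)
      case zero
      show ?case using xi zero_coeffs by (intro bexI[of _ "\<zero>\<^bsub>T\<^esub>"]) auto
    next
      case (tens c r)
      obtain s' t where st: "s' \<in> R" "t \<in> R" "x i \<otimes>\<^bsub>A\<^esub> r = s' \<otimes>\<^bsub>A\<^esub> x i \<oplus>\<^bsub>A\<^esub> t"
        using X.gen_past_coeff[OF i tens(2)] by blast
      then have "?x i \<otimes>\<^bsub>T\<^esub> tens c r = tens c s' \<otimes>\<^bsub>T\<^esub> ?x i \<oplus>\<^bsub>T\<^esub> tens c t"
        using tens xi R by (simp add: tens_mult tens_add_right)
      then show ?case using tens_coeffs[OF tens(1)] st by blast
    next
      case (minus a b)
      then obtain a' u b' v where ab: "a' \<in> coeffs" "u \<in> coeffs" "b' \<in> coeffs" "v \<in> coeffs"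
        "?x i \<otimes>\<^bsub>T\<^esub> a = a' \<otimes>\<^bsub>T\<^esub> ?x i \<oplus>\<^bsub>T\<^esub> u" "?x i \<otimes>\<^bsub>T\<^esub> b = b' \<otimes>\<^bsub>T\<^esub> ?x i \<oplus>\<^bsub>T\<^esub> v" by blast
      note cl = xi(1) minus(1,2)[THEN coeffs.subring_elem] ab(1-4)[THEN coeffs.subring_elem]
      have "?x i \<otimes>\<^bsub>T\<^esub> (a \<ominus>\<^bsub>T\<^esub> b) = ?x i \<otimes>\<^bsub>T\<^esub> a \<ominus>\<^bsub>T\<^esub> ?x i \<otimes>\<^bsub>T\<^esub> b"
        using cl by algebra
      also have "\<dots> = (a' \<ominus>\<^bsub>T\<^esub> b') \<otimes>\<^bsub>T\<^esub> ?x i \<oplus>\<^bsub>T\<^esub> (u \<ominus>\<^bsub>T\<^esub> v)"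
        unfolding ab(5,6) using cl by algebra
      finally show ?case using coeffs_minus ab(1-4) by blast
    qed
    show "\<exists>s'\<in>coeffs. \<exists>t\<in>coeffs. s \<otimes>\<^bsub>T\<^esub> ?x i = ?x i \<otimes>\<^bsub>T\<^esub> s' \<oplus>\<^bsub>T\<^esub> t"
      using s
    proof (induction rule: coeffs_induct)
      case zero
      show ?case using xi zero_coeffs by (intro bexI[of _ "\<zero>\<^bsub>T\<^esub>"]) auto
    next
      case (tens c r)
      obtain s' t where st: "s' \<in> R" "t \<in> R" "r \<otimes>\<^bsub>A\<^esub> x i = x i \<otimes>\<^bsub>A\<^esub> s' \<oplus>\<^bsub>A\<^esub> t"
        using X.coeff_past_gen[OF i tens(2)] by blast
      then have "tens c r \<otimes>\<^bsub>T\<^esub> ?x i = ?x i \<otimes>\<^bsub>T\<^esub> tens c s' \<oplus>\<^bsub>T\<^esub> tens c t"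
        using tens xi R by (simp add: tens_mult tens_add_right)
      then show ?case using tens_coeffs[OF tens(1)] st by blast
    next
      case (minus a b)
      then obtain a' u b' v where ab: "a' \<in> coeffs" "u \<in> coeffs" "b' \<in> coeffs" "v \<in> coeffs"
        "a \<otimes>\<^bsub>T\<^esub> ?x i = ?x i \<otimes>\<^bsub>T\<^esub> a' \<oplus>\<^bsub>T\<^esub> u" "b \<otimes>\<^bsub>T\<^esub> ?x i = ?x i \<otimes>\<^bsub>T\<^esub> b' \<oplus>\<^bsub>T\<^esub> v" by blast
      note cl = xi(1) minus(1,2)[THEN coeffs.subring_elem] ab(1-4)[THEN coeffs.subring_elem]
      have "(a \<ominus>\<^bsub>T\<^esub> b) \<otimes>\<^bsub>T\<^esub> ?x i = a \<otimes>\<^bsub>T\<^esub> ?x i \<ominus>\<^bsub>T\<^esub> b \<otimes>\<^bsub>T\<^esub> ?x i"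
        using cl by algebra
      also have "\<dots> = ?x i \<otimes>\<^bsub>T\<^esub> (a' \<ominus>\<^bsub>T\<^esub> b') \<oplus>\<^bsub>T\<^esub> (u \<ominus>\<^bsub>T\<^esub> v)"
        unfolding ab(5,6) using cl by algebra
      finally show ?case using coeffs_minus ab(1-4) by blast
    qed
  next
    fix i j assume ij: "i \<in> {1..n}" "j \<in> {1..n}"
    obtain c a where c: "c \<in> R" and a: "a \<in> left_span A R (insert \<one>\<^bsub>A\<^esub> (x ` {1..n}))"
      and eq: "x i \<otimes>\<^bsub>A\<^esub> x j = c \<otimes>\<^bsub>A\<^esub> (x j \<otimes>\<^bsub>A\<^esub> x i) \<oplus>\<^bsub>A\<^esub> a"
      using X.gen_past_gen[OF ij] by blast
    have sub: "insert \<one>\<^bsub>A\<^esub> (x ` {1..n}) \<subseteq> carrier A" using X.gens_closed by auto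
    have "tens \<one>\<^bsub>C\<^esub> a \<in> left_span T coeffs (insert \<one>\<^bsub>T\<^esub> (?x ` {1..n}))"
      using ring_hom_left_span[OF tens_one_hom subring_axioms sub coeffs a] by (simp add: image_image)
    moreover have "?x i \<otimes>\<^bsub>T\<^esub> ?x j = tens \<one>\<^bsub>C\<^esub> (x i \<otimes>\<^bsub>A\<^esub> x j)"
      using ij X.gens_closed by simp
    then have "?x i \<otimes>\<^bsub>T\<^esub> ?x j = tens \<one>\<^bsub>C\<^esub> c \<otimes>\<^bsub>T\<^esub> (?x j \<otimes>\<^bsub>T\<^esub> ?x i) \<oplus>\<^bsub>T\<^esub> tens \<one>\<^bsub>C\<^esub> a"
      unfolding eq using ij X.gens_closed R[OF c] X.left_span_carrier[OF sub a] by simp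
    ultimately show "\<exists>c\<in>coeffs. \<exists>a\<in>left_span T coeffs (insert \<one>\<^bsub>T\<^esub> (?x ` {1..n})).
        ?x i \<otimes>\<^bsub>T\<^esub> ?x j = c \<otimes>\<^bsub>T\<^esub> (?x j \<otimes>\<^bsub>T\<^esub> ?x i) \<oplus>\<^bsub>T\<^esub> a"
      using coeffs c by blast
  qed
qed

end

section \<open>Bijective skew PBW extensions\<close>

text \<open>For $s \in R$ take $r$ with $\sigma_i(r) = s$; then $s x_i = x_i r - \delta_i(r)$. The other
  conditions are read off from the definition.\<close>

lemma bijective_skew_PBW_extension_almost_normalizing:
  assumes "bijective_skew_PBW_extension A R n x"
  shows "almost_normalizing_extension A R n x"
proof -
  interpret B: bijective_skew_PBW_extension A R n x by fact
  interpret ring_with_subring A R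
    by (simp add: ring_with_subring_def B.ring_axioms B.subring_axioms)
  note R = subringE[OF B.subring_axioms]
  have gens: "x i \<in> carrier A" if "i \<in> {1..n}" for i
    using B.gens_closed that by (rule funcset_mem)
  let ?G = "insert \<one>\<^bsub>A\<^esub> (x ` {1..n})"
  have G: "?G \<subseteq> carrier A" using gens by auto
  have affine: "affine_part A R n x \<subseteq> left_span A R ?G"
  proof
    fix a assume "a \<in> affine_part A R n x"
    then obtain s r where sr: "s \<in> R" "r \<in> {1..n} \<rightarrow> R"
      "a = s \<oplus>\<^bsub>A\<^esub> (\<Oplus>\<^bsub>A\<^esub>i\<in>{1..n}. r i \<otimes>\<^bsub>A\<^esub> x i)"
      unfolding affine_part_def by blast
    have "s \<otimes>\<^bsub>A\<^esub> \<one>\<^bsub>A\<^esub> \<in> left_span A R ?G"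
      by (rule left_span_smult[OF G sr(1) left_span_incl[OF G]]) simp
    then have "s \<in> left_span A R ?G" using subring_elem[OF sr(1)] by simp
    moreover have "(\<Oplus>\<^bsub>A\<^esub>i\<in>{1..n}. r i \<otimes>\<^bsub>A\<^esub> x i) \<in> left_span A R ?G"
    proof (rule left_span_finsum[OF G])
      fix i assume "i \<in> {1..n}"
      then show "r i \<otimes>\<^bsub>A\<^esub> x i \<in> left_span A R ?G"
        using sr(2) by (intro left_span_smult[OF G] left_span_incl[OF G]) auto
    qed simp
    ultimately show "a \<in> left_span A R ?G" unfolding sr(3) by (rule left_span_add[OF G])
  qed
  show ?thesis
  proof (intro almost_normalizing_extension.intro almost_normalizing_extension_axioms.intro
      ring_with_subring_axioms)
    show "x i \<in> carrier A" if "i \<in> {1..n}" for i by (rule gens[OF that])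
  next
    let ?M = "std_monomial A n x ` exponents n"
    have "?M \<subseteq> carrier A"
      using B.monomial_basis unfolding left_module_basis_def by auto
    note M = left_span_smult[OF this] left_span_incl[OF this] left_span_finsum[OF this]
    show "carrier A \<subseteq> left_span A R ?M"
    proof
      fix a assume a: "a \<in> carrier A"
      obtain F r where F: "finite F" "F \<subseteq> exponents n" "r \<in> F \<rightarrow> R"
        "a = (\<Oplus>\<^bsub>A\<^esub>\<alpha>\<in>F. r \<alpha> \<otimes>\<^bsub>A\<^esub> std_monomial A n x \<alpha>)"
        using B.monomial_basis[unfolded left_module_basis_def, THEN conjunct2, THEN conjunct1,
            rule_format, OF a] by auto
      show "a \<in> left_span A R ?M"
        unfolding F(4)
      proof (rule M(3)[OF F(1)])
        fix \<alpha> assume "\<alpha> \<in> F"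
        then show "r \<alpha> \<otimes>\<^bsub>A\<^esub> std_monomial A n x \<alpha> \<in> left_span A R ?M"
          using F(2,3) by (intro M(1,2)) auto
      qed
    qed
  next
    fix i s assume i: "i \<in> {1..n}" and s: "s \<in> R"
    note xs = gens[OF i] subring_elem[OF s]
    show "\<exists>s'\<in>R. \<exists>t\<in>R. x i \<otimes>\<^bsub>A\<^esub> s = s' \<otimes>\<^bsub>A\<^esub> x i \<oplus>\<^bsub>A\<^esub> t"
    proof (cases "s = \<zero>\<^bsub>A\<^esub>")
      case True
      then have "x i \<otimes>\<^bsub>A\<^esub> s = \<zero>\<^bsub>A\<^esub> \<otimes>\<^bsub>A\<^esub> x i \<oplus>\<^bsub>A\<^esub> \<zero>\<^bsub>A\<^esub>" using xs by simp
      then show ?thesis using R(2) by blast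
    next
      case False
      then obtain c where c: "c \<in> R" "x i \<otimes>\<^bsub>A\<^esub> s \<ominus>\<^bsub>A\<^esub> c \<otimes>\<^bsub>A\<^esub> x i \<in> R"
        using B.gen_coeff[OF i, of s] s by blast
      have "x i \<otimes>\<^bsub>A\<^esub> s = c \<otimes>\<^bsub>A\<^esub> x i \<oplus>\<^bsub>A\<^esub> (x i \<otimes>\<^bsub>A\<^esub> s \<ominus>\<^bsub>A\<^esub> c \<otimes>\<^bsub>A\<^esub> x i)"
        using xs subring_elem[OF c(1)] by algebra
      then show ?thesis using c by blast
    qed
    obtain \<sigma> \<delta> where twist: "gen_twist A R (x i) \<sigma> \<delta>" and bij: "bij_betw \<sigma> R R"
      using B.twist_bijective[OF i] by blast
    obtain r where r: "r \<in> R" "s = \<sigma> r"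
      using bij s unfolding bij_betw_def by auto
    have \<delta>: "\<delta> r \<in> R" and eq: "x i \<otimes>\<^bsub>A\<^esub> r = s \<otimes>\<^bsub>A\<^esub> x i \<oplus>\<^bsub>A\<^esub> \<delta> r"
      using twist r unfolding gen_twist_def skew_derivation_def by auto
    have "s \<otimes>\<^bsub>A\<^esub> x i = x i \<otimes>\<^bsub>A\<^esub> r \<oplus>\<^bsub>A\<^esub> \<ominus>\<^bsub>A\<^esub> \<delta> r"
      unfolding eq using xs subring_elem[OF \<delta>] by algebra
    then show "\<exists>s'\<in>R. \<exists>t\<in>R. s \<otimes>\<^bsub>A\<^esub> x i = x i \<otimes>\<^bsub>A\<^esub> s' \<oplus>\<^bsub>A\<^esub> t"
      using r(1) R(5)[OF \<delta>] by blast
  next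
    fix i j assume ij: "i \<in> {1..n}" "j \<in> {1..n}"
    obtain c where c: "c \<in> R"
      "x i \<otimes>\<^bsub>A\<^esub> x j \<ominus>\<^bsub>A\<^esub> c \<otimes>\<^bsub>A\<^esub> (x j \<otimes>\<^bsub>A\<^esub> x i) \<in> affine_part A R n x" (is "?a \<in> _")
      using B.gen_gen[OF ij(2,1)] by blast
    have "x i \<otimes>\<^bsub>A\<^esub> x j = c \<otimes>\<^bsub>A\<^esub> (x j \<otimes>\<^bsub>A\<^esub> x i) \<oplus>\<^bsub>A\<^esub> ?a"
      using gens[OF ij(1)] gens[OF ij(2)] subring_elem[OF c(1)] by algebra
    then show "\<exists>c\<in>R. \<exists>a\<in>left_span A R ?G. x i \<otimes>\<^bsub>A\<^esub> x j = c \<otimes>\<^bsub>A\<^esub> (x j \<otimes>\<^bsub>A\<^esub> x i) \<oplus>\<^bsub>A\<^esub> a"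
      using c affine by blast
  qed
qed

theorem theorem4p3:
  fixes K :: "'k ring"
    and A :: "('k, 'a) module"
    and R :: "'a set"
    and n :: nat
    and x :: "nat \<Rightarrow> 'a"
  assumes "cring K"
    and "ring_algebra K A"
    and "bijective_skew_PBW_extension A R n x"
    and "left_strongly_noetherian TYPE('c) K (A\<lparr>carrier := R\<rparr>)"
  shows "left_strongly_noetherian TYPE('c) K A"
proof -
  have ext: "almost_normalizing_extension A R n x"
    by (rule bijective_skew_PBW_extension_almost_normalizing[OF assms(3)])
  interpret X: almost_normalizing_extension A R n x by (rule ext)
  have R: "ring_algebra K (A\<lparr>carrier := R\<rparr>)" "left_noetherian_ring (A\<lparr>carrier := R\<rparr>)"
    and tensor: "\<And>C :: ('k, 'c) module. \<lbrakk>algebra K C; noetherian_ring C\<rbrakk> \<Longrightarrow>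
      left_noetherian_ring (tensor_algebra_ring K C (A\<lparr>carrier := R\<rparr>))"
    using assms(4) unfolding left_strongly_noetherian_def by auto
  have "left_noetherian_ring (tensor_algebra_ring K C A)"
    if C: "algebra K C" "noetherian_ring C" for C :: "('k, 'c) module"
  proof -
    interpret subalgebra_tensor K C A R
      by (intro subalgebra_tensor.intro algebra_tensor.intro subalgebra_tensor_axioms.intro
          ring_algebra_commutative[OF C(1)] assms(2) R(1) X.subring_axioms)
    show ?thesis
      by (rule almost_normalizing_extension.left_noetherian[OF tensor_extension[OF ext]
            left_noetherian_coeffs[OF tensor[OF C]]])
  qed
  moreover have "left_noetherian_ring A" by (rule X.left_noetherian[OF R(2)])
  ultimately show ?thesis
    unfolding left_strongly_noetherian_def using assms(2) by blast
qed

end
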